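(* Let $F,\Delta,k$ be fixed integers. There is a polynomial-time algorithm which, given a graph $G=(V,E)$ rooted in $d$ with maximum degree at most $\Delta$, together with a canonical tree decomposition $(W,b)$ of $G$ of width $k-1$, a function $f:E^s\to\mathbb{N}$ with $f(e)\le F$ for all $e\in E^s$, and a function $g:E^s\times\{1,\dots,F\}\to\mathbb{N}$, decides whether there exists a closed walk $w$ starting at $d$ such that (i) every edge $e$ is traversed exactly $f(e)$ times in each of the two directions, and (ii) for every edge $e$ and every $y\le f(e)$ there are at most $g(e,y)$ steps between the $y$-th and the $(y+1)$-st traversals of $e$, taken cyclically.
   Context: $G^s=(V,E^s)$ is the symmetric orientation of $G$ (each edge replaced by two opposite arcs). A tree decomposition of $G$ is a pair $(W,b)$ with $W$ a tree and $b:V(W)\to 2^{V(G)}$ assigning bags, such that every vertex of $G$ lies in some bag, every edge of $G$ is contained in some bag, and for each vertex of $G$ the bags containing it form a connected subtree of $W$; its width is the maximum bag size minus one. It is canonical if $W$ is rooted at a vertex $r$ with $d\in b(r)$, each leaf $u$ has $|b(u)|=1$, and each non-leaf $u$ either has exactly one son $u'$ with $b(u)=b(u')\cup\{v\}$ for some $v\in V$, or exactly one son $u'$ with $b(u)=b(u')\setminus\{v\}$ for some $v\in V$, or exactly two sons $u',u''$ with $b(u)=b(u')=b(u'')$. *)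

theory Defs
  imports
    "Graph_Theory.Graph_Theory"
    "HOL-Computational_Algebra.Polynomial"
begin

section \<open>Polynomial-time algorithms\<close>

text \<open>
  The model of computation is the first-order call-by-value functional language over binary trees
  (``pure S-expressions''), with the number of evaluation steps as running time; see N. D. Jones,
  Computability and Complexity from a Programming Perspective, MIT Press 1997.  Trees are immutable
  and can only be taken apart, paired, and compared with the empty tree, so that a step
  manipulates a bounded number of pointers.  Hence the problems decidable in time polynomial in the
  size of the input tree are exactly those in PTIME in the sense of Turing machines.
\<close>

datatype val = Lf | Nd val val

primrec lft :: "val \<Rightarrow> val" where
  "lft Lf = Lf"
| "lft (Nd a b) = a"

primrec rgt :: "val \<Rightarrow> val" where
  "rgt Lf = Lf"
| "rgt (Nd a b) = b"

text \<open>
  Variables are de Bruijn indices into the environment.  A program is a list of function bodies;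
  the body of a function is evaluated in the environment consisting of its arguments.
\<close>

datatype exp =
    Var nat
  | ELf
  | ENd exp exp
  | Lft exp
  | Rgt exp
  | If exp exp exp
  | Let exp exp
  | Call nat "exp list"

type_synonym program = "exp list"

inductive
  eval :: "program \<Rightarrow> val list \<Rightarrow> exp \<Rightarrow> val \<Rightarrow> nat \<Rightarrow> bool" and
  evals :: "program \<Rightarrow> val list \<Rightarrow> exp list \<Rightarrow> val list \<Rightarrow> nat \<Rightarrow> bool"
  for P :: program
where
  eval_Var: "i < length env \<Longrightarrow> eval P env (Var i) (env ! i) 1"
| eval_ELf: "eval P env ELf Lf 1"
| eval_ENd: "eval P env e1 v1 t1 \<Longrightarrow> eval P env e2 v2 t2 \<Longrightarrow>
    eval P env (ENd e1 e2) (Nd v1 v2) (t1 + t2 + 1)"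
| eval_Lft: "eval P env e v t \<Longrightarrow> eval P env (Lft e) (lft v) (t + 1)"
| eval_Rgt: "eval P env e v t \<Longrightarrow> eval P env (Rgt e) (rgt v) (t + 1)"
| eval_If_True: "eval P env e0 v0 t0 \<Longrightarrow> v0 \<noteq> Lf \<Longrightarrow> eval P env e1 v t \<Longrightarrow>
    eval P env (If e0 e1 e2) v (t0 + t + 1)"
| eval_If_False: "eval P env e0 Lf t0 \<Longrightarrow> eval P env e2 v t \<Longrightarrow>
    eval P env (If e0 e1 e2) v (t0 + t + 1)"
| eval_Let: "eval P env e1 v1 t1 \<Longrightarrow> eval P (v1 # env) e2 v t \<Longrightarrow>
    eval P env (Let e1 e2) v (t1 + t + 1)"
| eval_Call: "i < length P \<Longrightarrow> evals P env es vs t1 \<Longrightarrow> eval P vs (P ! i) v t2 \<Longrightarrow>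
    eval P env (Call i es) v (t1 + t2 + 1)"
| evals_Nil: "evals P env [] [] 0"
| evals_Cons: "eval P env e v t1 \<Longrightarrow> evals P env es vs t2 \<Longrightarrow>
    evals P env (e # es) (v # vs) (t1 + t2)"

lemma eval_deterministic:
  "eval P env e v t \<Longrightarrow> eval P env e v' t' \<Longrightarrow> v' = v \<and> t' = t"
  "evals P env es vs s \<Longrightarrow> evals P env es vs' s' \<Longrightarrow> vs' = vs \<and> s' = s"
proof (induction arbitrary: v' t' and vs' s' rule: eval_evals.inducts)
  case (eval_If_True env e0 v0 t0 e1 v t e2)
  from eval_If_True.prems show ?case
    by (cases rule: eval.cases) (use eval_If_True.IH eval_If_True.hyps in blast)+
next
  case (eval_If_False env e0 t0 e2 v t e1)
  from eval_If_False.prems show ?case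
    by (cases rule: eval.cases) (use eval_If_False.IH in blast)+
qed (erule eval.cases evals.cases; blast)+

text \<open>The main function is function \<open>0\<close>; it is applied to the single input \<open>x\<close>.\<close>

definition computes_in :: "program \<Rightarrow> val \<Rightarrow> val \<Rightarrow> nat \<Rightarrow> bool" where
  "computes_in P x v t \<longleftrightarrow> eval P [x] (Call 0 [Var 0]) v t"

text \<open>
  \<open>promise\<close> delimits the admissible instances, \<open>enc I x\<close> says that the tree \<open>x\<close> is an encoding of
  the instance \<open>I\<close>, and \<open>question I\<close> is what has to be decided.  The generated function \<open>size\<close> on
  trees counts the inner nodes.  Rejection is the value \<open>Lf\<close>, acceptance the value \<open>Nd Lf Lf\<close>.
\<close>

definition poly_time_decidable ::
  "('i \<Rightarrow> bool) \<Rightarrow> ('i \<Rightarrow> val \<Rightarrow> bool) \<Rightarrow> ('i \<Rightarrow> bool) \<Rightarrow> bool" where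
  "poly_time_decidable promise enc question \<longleftrightarrow>
     (\<exists>(P :: program) (q :: nat poly). \<forall>I x. promise I \<longrightarrow> enc I x \<longrightarrow>
        (\<exists>t \<le> poly q (size x). computes_in P x (if question I then Nd Lf Lf else Lf) t))"


section \<open>Encodings\<close>

text \<open>Binary notation, least significant bit first, without leading zeros.\<close>

fun nat_val :: "nat \<Rightarrow> val" where
  "nat_val n = (if n = 0 then Lf else Nd (if odd n then Nd Lf Lf else Lf) (nat_val (n div 2)))"

declare nat_val.simps [simp del]

primrec list_val :: "val list \<Rightarrow> val" where
  "list_val [] = Lf"
| "list_val (x # xs) = Nd x (list_val xs)"

definition enc_nat :: "nat \<Rightarrow> val \<Rightarrow> bool" where
  "enc_nat n x \<longleftrightarrow> x = nat_val n"

definition enc_pair ::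
  "('a \<Rightarrow> val \<Rightarrow> bool) \<Rightarrow> ('b \<Rightarrow> val \<Rightarrow> bool) \<Rightarrow> 'a \<times> 'b \<Rightarrow> val \<Rightarrow> bool" where
  "enc_pair R S p x \<longleftrightarrow> (\<exists>y z. x = Nd y z \<and> R (fst p) y \<and> S (snd p) z)"

text \<open>Finite sets are listed without repetitions, in any order.\<close>

definition enc_set :: "('a \<Rightarrow> val \<Rightarrow> bool) \<Rightarrow> 'a set \<Rightarrow> val \<Rightarrow> bool" where
  "enc_set R A x \<longleftrightarrow>
     (\<exists>as ys. distinct as \<and> set as = A \<and> list_all2 R as ys \<and> x = list_val ys)"

definition enc_fun ::
  "('a \<Rightarrow> val \<Rightarrow> bool) \<Rightarrow> ('b \<Rightarrow> val \<Rightarrow> bool) \<Rightarrow> 'a set \<Rightarrow> ('a \<Rightarrow> 'b) \<Rightarrow> val \<Rightarrow> bool" where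
  "enc_fun R S A f x \<longleftrightarrow> enc_set (enc_pair R S) ((\<lambda>a. (a, f a)) ` A) x"


section \<open>Graphs and canonical tree decompositions\<close>

definition simple_graph :: "'a set \<Rightarrow> 'a set set \<Rightarrow> bool" where
  "simple_graph V E \<longleftrightarrow> finite V \<and> (\<forall>e\<in>E. e \<subseteq> V \<and> card e = 2)"

definition degree :: "'a set set \<Rightarrow> 'a \<Rightarrow> nat" where
  "degree E v = card {e \<in> E. v \<in> e}"

definition sym_arcs :: "'a set set \<Rightarrow> ('a \<times> 'a) set" where
  "sym_arcs E = {(u, v). {u, v} \<in> E}"

definition sym_orientation :: "'a set \<Rightarrow> 'a set set \<Rightarrow> ('a, 'a \<times> 'a) pre_digraph" where
  "sym_orientation V E = with_proj \<lparr> pverts = V, parcs = sym_arcs E \<rparr>"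

text \<open>
  In a symmetric orientation every edge gives rise to cycles of length 2 in the sense of
  \<^const>\<open>pre_digraph.cycle\<close>; the cycles of the undirected graph are those of length at least 3.
  For this reason the predicate \<^const>\<open>tree\<close> for digraphs is not applicable here.
\<close>

definition undirected_tree :: "'a set \<Rightarrow> 'a set set \<Rightarrow> bool" where
  "undirected_tree V E \<longleftrightarrow> simple_graph V E \<and> connected (sym_orientation V E) \<and>
     \<not> (\<exists>p. pre_digraph.cycle (sym_orientation V E) p \<and> length p \<ge> 3)"

definition tree_decomposition ::
  "'a set \<Rightarrow> 'a set set \<Rightarrow> 'n set \<Rightarrow> 'n set set \<Rightarrow> ('n \<Rightarrow> 'a set) \<Rightarrow> bool" where
  "tree_decomposition V E N T b \<longleftrightarrow>
     undirected_tree N T \<and>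
     (\<forall>x\<in>N. b x \<subseteq> V) \<and>
     (\<forall>v\<in>V. \<exists>x\<in>N. v \<in> b x) \<and>
     (\<forall>e\<in>E. \<exists>x\<in>N. e \<subseteq> b x) \<and>
     (\<forall>v\<in>V. connected (sym_orientation {x\<in>N. v \<in> b x} {e\<in>T. \<forall>x\<in>e. v \<in> b x}))"

definition width :: "'n set \<Rightarrow> ('n \<Rightarrow> 'a set) \<Rightarrow> int" where
  "width N b = int (Max ((\<lambda>x. card (b x)) ` N)) - 1"

text \<open>The sons of \<open>u\<close> are the nodes whose path from the root \<open>r\<close> has \<open>u\<close> as its last but one node.\<close>

definition sons :: "'n set \<Rightarrow> 'n set set \<Rightarrow> 'n \<Rightarrow> 'n \<Rightarrow> 'n set" where
  "sons N T r u = {u'. \<exists>p. pre_digraph.apath (sym_orientation N T) r (p @ [(u, u')]) u'}"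

definition canonical_tree_decomposition ::
  "'a set \<Rightarrow> 'a set set \<Rightarrow> 'a \<Rightarrow> 'n set \<Rightarrow> 'n set set \<Rightarrow> 'n \<Rightarrow> ('n \<Rightarrow> 'a set) \<Rightarrow> bool" where
  "canonical_tree_decomposition V E d N T r b \<longleftrightarrow>
     tree_decomposition V E N T b \<and> r \<in> N \<and> d \<in> b r \<and>
     (\<forall>u\<in>N.
        (sons N T r u = {} \<and> card (b u) = 1) \<or>
        (\<exists>u'. \<exists>v\<in>V. sons N T r u = {u'} \<and> b u = b u' \<union> {v}) \<or>
        (\<exists>u'. \<exists>v\<in>V. sons N T r u = {u'} \<and> b u = b u' - {v}) \<or>
        (\<exists>u' u''. u' \<noteq> u'' \<and> sons N T r u = {u', u''} \<and> b u = b u' \<and> b u = b u''))"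


section \<open>The decision problem\<close>

text \<open>
  An instance: the graph \<open>(gV, gE)\<close> rooted in \<open>gd\<close>, the tree \<open>(tV, tE)\<close> rooted in \<open>tr\<close> with bags
  \<open>bag\<close>, and the functions \<open>f\<close> and \<open>g\<close>.  Only the values of \<open>f\<close> on \<open>sym_arcs gE\<close>, of \<open>g\<close> on
  \<open>sym_arcs gE \<times> {1..F}\<close> and of \<open>bag\<close> on \<open>tV\<close> belong to the instance.
\<close>

record walk_instance =
  gV :: "nat set"
  gE :: "nat set set"
  gd :: nat
  tV :: "nat set"
  tE :: "nat set set"
  tr :: nat
  bag :: "nat \<Rightarrow> nat set"
  fI :: "nat \<times> nat \<Rightarrow> nat"
  gI :: "(nat \<times> nat) \<times> nat \<Rightarrow> nat"

definition admissible :: "nat \<Rightarrow> nat \<Rightarrow> nat \<Rightarrow> walk_instance \<Rightarrow> bool" where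
  "admissible F \<Delta> k I \<longleftrightarrow>
     simple_graph (gV I) (gE I) \<and> gd I \<in> gV I \<and>
     (\<forall>v\<in>gV I. degree (gE I) v \<le> \<Delta>) \<and>
     canonical_tree_decomposition (gV I) (gE I) (gd I) (tV I) (tE I) (tr I) (bag I) \<and>
     width (tV I) (bag I) = int k - 1 \<and>
     (\<forall>e\<in>sym_arcs (gE I). fI I e \<le> F)"

definition enc_instance :: "nat \<Rightarrow> walk_instance \<Rightarrow> val \<Rightarrow> bool" where
  "enc_instance F I x \<longleftrightarrow>
     (\<exists>x1 x2 x3 x4 x5 x6 x7 x8 x9. x = list_val [x1, x2, x3, x4, x5, x6, x7, x8, x9] \<and>
        enc_set enc_nat (gV I) x1 \<and>
        enc_set (enc_set enc_nat) (gE I) x2 \<and>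
        enc_nat (gd I) x3 \<and>
        enc_set enc_nat (tV I) x4 \<and>
        enc_set (enc_set enc_nat) (tE I) x5 \<and>
        enc_nat (tr I) x6 \<and>
        enc_fun enc_nat (enc_set enc_nat) (tV I) (bag I) x7 \<and>
        enc_fun (enc_pair enc_nat enc_nat) enc_nat (sym_arcs (gE I)) (fI I) x8 \<and>
        enc_fun (enc_pair (enc_pair enc_nat enc_nat) enc_nat) enc_nat
          (sym_arcs (gE I) \<times> {1..F}) (gI I) x9)"

definition traversals :: "'e list \<Rightarrow> 'e \<Rightarrow> nat list" where
  "traversals w e = filter (\<lambda>i. w ! i = e) [0..<length w]"

text \<open>
  The number of steps strictly between the \<open>y\<close>-th traversal of \<open>e\<close> (\<open>1 \<le> y\<close>) and the next one; the
  last traversal is followed by the first one in the next round of the closed walk \<open>w\<close>.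
\<close>

definition steps_between :: "'e list \<Rightarrow> 'e \<Rightarrow> nat \<Rightarrow> nat" where
  "steps_between w e y =
     (let p = traversals w e in
      if y < length p then p ! y - p ! (y - 1) - 1
      else length w + p ! 0 - p ! (y - 1) - 1)"

definition has_walk :: "walk_instance \<Rightarrow> bool" where
  "has_walk I \<longleftrightarrow>
     (\<exists>w. pre_digraph.awalk (sym_orientation (gV I) (gE I)) (gd I) w (gd I) \<and>
        (\<forall>e\<in>sym_arcs (gE I). length (traversals w e) = fI I e) \<and>
        (\<forall>e\<in>sym_arcs (gE I). \<forall>y\<in>{1..fI I e}. steps_between w e y \<le> gI I (e, y)))"

end

(*
  Give each vertex v its timetable: the pairs (t, e) of a time t and an arc e at v such that e is
  traversed at time t.  As f and the degrees are bounded, there are polynomially many timetables.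
  Whether timetables come from a closed walk can be checked at single vertices (number and gaps of
  the traversals of each incident arc; whoever arrives at time t leaves at time t + 1 modulo the
  length L of the walk; only d may be left at time 0) and at single edges (both ends agree).  There
  is no global condition: exactly L traversals are scheduled and the scheduled times are closed
  under the cyclic successor, so each time is used exactly once.

  This is a binary constraint satisfaction problem on a graph of treewidth less than k, so it is
  solved by k-consistency: the greatest family of k-tuples of locally compatible choices in which
  k - 1 members of a tuple can be kept while the remaining one moves to any vertex.  Hence the
  algorithm does not look at the tree decomposition; it is only needed to glue tuples of a nonempty
  family to a global solution, bag by bag.
*)

theory Submission
  imports Defs
begin

section \<open>A calculus of polynomial-time functions\<close>

text \<open>Timetables sit at vertices rather than at arcs because each condition then concerns one
  vertex or the two ends of one edge, and every vertex and every edge lies in some bag. Absolute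
  times are available because the length of the walk is known in advance: it is the sum of the
  values of \<open>f\<close>. At most \<Delta> edges at a vertex give at most 2\<Delta> arcs, each
  traversed at most \<open>F\<close> times; this is the origin of the timetable length
  \<open>2 * D * F\<close>.

  On the computational side, closure properties of the polynomial-time functions are proved once,
  and the procedure is composed from them. Functions take a single tree, so below a binder the
  surrounding parameter is passed as the left component of a pair. Polynomial running time is shown
  for all trees, correctness only for encodings of admissible instances.\<close>

lemma poly_nat_mono: "m \<le> n \<Longrightarrow> poly (q :: nat poly) m \<le> poly q n"
  by (induction q) (auto intro!: add_mono mult_mono)

section \<open>Relocating a program inside a larger one\<close>

lemmas evalI = eval_evals.intros[unfolded One_nat_def add_Suc_right add_0_right]

text \<open>Calls name absolute positions in the program, so code placed behind \<open>n\<close>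
  other functions needs its calls shifted by \<open>n\<close>.\<close>

primrec link :: "nat \<Rightarrow> exp \<Rightarrow> exp" where
  "link n (Var i) = Var i"
| "link n ELf = ELf"
| "link n (ENd a b) = ENd (link n a) (link n b)"
| "link n (Lft a) = Lft (link n a)"
| "link n (Rgt a) = Rgt (link n a)"
| "link n (If a b c) = If (link n a) (link n b) (link n c)"
| "link n (Let a b) = Let (link n a) (link n b)"
| "link n (Call i es) = Call (n + i) (map (link n) es)"

lemma eval_link:
  "eval P env e v t \<Longrightarrow> eval (A @ map (link (length A)) P @ C) env (link (length A) e) v t"
  "evals P env es vs s \<Longrightarrow>
    evals (A @ map (link (length A)) P @ C) env (map (link (length A)) es) vs s"
  by (induction rule: eval_evals.inducts) (auto intro: evalI simp: nth_append)

text \<open>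
  The size of the output is bounded separately: as subtrees are shared, \<open>t\<close> steps can produce a tree
  of size exponential in \<open>t\<close>.
\<close>

definition runs :: "program \<Rightarrow> nat \<Rightarrow> (val \<Rightarrow> val) \<Rightarrow> nat poly \<Rightarrow> bool" where
  "runs P i f q \<longleftrightarrow> i < length P \<and>
     (\<forall>x. size (f x) \<le> poly q (size x) \<and> (\<exists>t \<le> poly q (size x). eval P [x] (P ! i) (f x) t))"

definition ptime :: "(val \<Rightarrow> val) \<Rightarrow> bool" where
  "ptime f \<longleftrightarrow> (\<exists>P q. runs P 0 f q)"

lemma eval_Call1:
  assumes "eval P env e x s" "i < length P" "eval P [x] (P ! i) v t"
  shows "eval P env (Call i [e]) v (s + t + 1)"
  using eval_Call[OF assms(2) evals_Cons[OF assms(1) evals_Nil] assms(3)] by simp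

lemma runs_call:
  assumes "runs P i f q" "eval P env e x s"
  obtains t where "eval P env (Call i [e]) (f x) t" "t \<le> s + poly q (size x) + 1"
proof -
  from assms(1) obtain t where t: "t \<le> poly q (size x)" "eval P [x] (P ! i) (f x) t" "i < length P"
    unfolding runs_def by blast
  from eval_Call1[OF assms(2) t(3,2)] show thesis using t(1) that by auto
qed

text \<open>The code \<open>B\<close> depends on the offset alone, while the surroundings
  \<open>A\<close> and \<open>C\<close> stay free. Hence the parts of a program can be obtained one
  by one, each offset being known from the lengths of the parts before it, and be assembled
  afterwards.\<close>

lemma ptime_link:
  assumes "ptime f"
  obtains B q where "\<And>A C. length A = n \<Longrightarrow> runs (A @ B @ C) n f q"
proof -
  from assms obtain P q where P: "runs P 0 f q" unfolding ptime_def by blast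
  have "runs (A @ map (link n) P @ C) n f q" if "length A = n" for A C
    unfolding runs_def
  proof (intro conjI allI)
    show "n < length (A @ map (link n) P @ C)" using P that by (simp add: runs_def)
    fix x
    show "size (f x) \<le> poly q (size x)" using P by (simp add: runs_def)
    from P obtain t where "t \<le> poly q (size x)" "eval P [x] (P ! 0) (f x) t" "0 < length P"
      unfolding runs_def by blast
    then show "\<exists>t\<le>poly q (size x).
        eval (A @ map (link n) P @ C) [x] ((A @ map (link n) P @ C) ! n) (f x) t"
      using eval_link(1)[of P "[x]" "P ! 0" "f x" t A C] that by (auto simp: nth_append)
  qed
  then show thesis using that by blast
qed

lemma ptimeI:
  assumes "\<And>x. size (f x) \<le> poly p (size x)"
    and "\<And>x. \<exists>t \<le> poly q (size x). eval (e # P) [x] e (f x) t"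
  shows "ptime f"
  unfolding ptime_def
proof (intro exI)
  show "runs (e # P) 0 f (p + q)"
    unfolding runs_def using assms by (simp add: trans_le_add1) (meson trans_le_add2)
qed

section \<open>Closure under the operations of the language\<close>

lemma ptime_id: "ptime (\<lambda>z. z)"
  by (rule ptimeI[where e = "Var 0" and p = "[:0, 1:]" and q = 1 and P = "[]"])
    (auto intro: evalI(1)[of 0 "[_]", simplified])

lemma ptime_Lf: "ptime (\<lambda>z. Lf)"
  by (rule ptimeI[where e = ELf and p = 0 and q = 1 and P = "[]"]) (auto intro: evalI)

lemma ptime_comp:
  assumes "ptime g" "ptime f"
  shows "ptime (\<lambda>z. g (f z))"
proof -
  from ptime_link[OF assms(1), of 1] obtain Bg qg where
    g: "\<And>A C. length A = 1 \<Longrightarrow> runs (A @ Bg @ C) 1 g qg" by blast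
  from ptime_link[OF assms(2), of "1 + length Bg"] obtain Bf qf where
    f: "\<And>A C. length A = 1 + length Bg \<Longrightarrow> runs (A @ Bf @ C) (1 + length Bg) f qf" by blast
  define e where "e = Call 1 [Call (1 + length Bg) [Var 0]]"
  define P where "P = e # Bg @ Bf"
  have rg: "runs P 1 g qg" using g[of "[e]" Bf] by (simp add: P_def)
  have rf: "runs P (1 + length Bg) f qf" using f[of "e # Bg" "[]"] by (simp add: P_def)
  show ?thesis
  proof (rule ptimeI[where e = e and P = "Bg @ Bf" and p = "pcompose qg qf"
      and q = "pcompose qg qf + qf + 3"])
    fix x
    have sf: "size (f x) \<le> poly qf (size x)" using rf by (simp add: runs_def)
    \<comment> \<open>The cost of \<open>g\<close> is polynomial in the size of the intermediate
      value; the size bound for \<open>f\<close> turns this into a polynomial in the size of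
      \<open>x\<close>.\<close>
    have gm: "poly qg (size (f x)) \<le> poly qg (poly qf (size x))"
      using poly_nat_mono[OF sf] .
    show "size (g (f x)) \<le> poly (pcompose qg qf) (size x)"
      using rg gm by (simp add: runs_def poly_pcompose) (meson le_trans)
    have v: "eval P [x] (Var 0) x 1" using eval_Var[of 0 "[x]"] by simp
    from runs_call[OF rf v] obtain t1 where t1: "eval P [x] (Call (1 + length Bg) [Var 0]) (f x) t1"
      "t1 \<le> 1 + poly qf (size x) + 1" .
    from runs_call[OF rg t1(1)] obtain t2 where "eval P [x] e (g (f x)) t2"
      "t2 \<le> t1 + poly qg (size (f x)) + 1" unfolding e_def .
    with t1(2) gm show "\<exists>t\<le>poly (pcompose qg qf + qf + 3) (size x). eval (e # Bg @ Bf) [x] e (g (f x)) t"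
      by (intro exI[of _ t2]) (auto simp: P_def poly_pcompose)
  qed
qed

lemma ptime_Nd:
  assumes "ptime f" "ptime g"
  shows "ptime (\<lambda>z. Nd (f z) (g z))"
proof -
  from ptime_link[OF assms(2), of 1] obtain Bg qg where
    g: "\<And>A C. length A = 1 \<Longrightarrow> runs (A @ Bg @ C) 1 g qg" by blast
  from ptime_link[OF assms(1), of "1 + length Bg"] obtain Bf qf where
    f: "\<And>A C. length A = 1 + length Bg \<Longrightarrow> runs (A @ Bf @ C) (1 + length Bg) f qf" by blast
  define e where "e = ENd (Call (1 + length Bg) [Var 0]) (Call 1 [Var 0])"
  define P where "P = e # Bg @ Bf"
  have rg: "runs P 1 g qg" using g[of "[e]" Bf] by (simp add: P_def)
  have rf: "runs P (1 + length Bg) f qf" using f[of "e # Bg" "[]"] by (simp add: P_def)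
  show ?thesis
  proof (rule ptimeI[where e = e and P = "Bg @ Bf" and p = "qg + qf + 1" and q = "qg + qf + 5"])
    fix x
    have sf: "size (f x) \<le> poly qf (size x)" using rf by (simp add: runs_def)
    have sg: "size (g x) \<le> poly qg (size x)" using rg by (simp add: runs_def)
    show "size (Nd (f x) (g x)) \<le> poly (qg + qf + 1) (size x)"
      using sf sg by simp
    have v: "eval P [x] (Var 0) x 1" using eval_Var[of 0 "[x]"] by simp
    from runs_call[OF rf v] obtain t1 where t1: "eval P [x] (Call (1 + length Bg) [Var 0]) (f x) t1"
      "t1 \<le> 1 + poly qf (size x) + 1" .
    from runs_call[OF rg v] obtain t2 where t2: "eval P [x] (Call 1 [Var 0]) (g x) t2"
      "t2 \<le> 1 + poly qg (size x) + 1" .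
    show "\<exists>t\<le>poly (qg + qf + 5) (size x). eval (e # Bg @ Bf) [x] e (Nd (f x) (g x)) t"
      using eval_ENd[OF t1(1) t2(1)] t1(2) t2(2) unfolding e_def[symmetric] P_def
      by (intro exI conjI) auto
  qed
qed

lemma ptime_lft: "ptime f \<Longrightarrow> ptime (\<lambda>z. lft (f z))"
proof (rule ptime_comp[of lft])
  show "ptime lft"
  proof (rule ptimeI[where e = "Lft (Var 0)" and p = "[:0, 1:]" and q = 2 and P = "[]"])
    fix x show "size (lft x) \<le> poly [:0, 1:] (size x)" by (cases x) auto
    show "\<exists>t\<le>poly 2 (size x). eval [Lft (Var 0)] [x] (Lft (Var 0)) (lft x) t"
      by (rule exI[of _ "1 + 1"]) (use eval_Lft[OF eval_Var[of 0 "[x]"]] in auto)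
  qed
qed

lemma ptime_rgt: "ptime f \<Longrightarrow> ptime (\<lambda>z. rgt (f z))"
proof (rule ptime_comp[of rgt])
  show "ptime rgt"
  proof (rule ptimeI[where e = "Rgt (Var 0)" and p = "[:0, 1:]" and q = 2 and P = "[]"])
    fix x show "size (rgt x) \<le> poly [:0, 1:] (size x)" by (cases x) auto
    show "\<exists>t\<le>poly 2 (size x). eval [Rgt (Var 0)] [x] (Rgt (Var 0)) (rgt x) t"
      by (rule exI[of _ "1 + 1"]) (use eval_Rgt[OF eval_Var[of 0 "[x]"]] in auto)
  qed
qed

lemma ptime_const: "ptime (\<lambda>z. c)"
  by (induction c) (auto intro: ptime_Lf ptime_Nd)

text \<open>
  Both branches are evaluated before the choice is made, which reduces the conditional to one fixed
  function.
\<close>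

lemma ptime_If_Lf:
  assumes "ptime c" "ptime f" "ptime g"
  shows "ptime (\<lambda>z. if c z = Lf then g z else f z)"
proof -
  define h where "h = (\<lambda>z. if lft z = Lf then rgt (rgt z) else lft (rgt z))"
  define e where "e = If (Lft (Var 0)) (Lft (Rgt (Var 0))) (Rgt (Rgt (Var 0)))"
  have "ptime h"
  proof (rule ptimeI[where e = e and p = "[:0, 1:]" and q = "6" and P = "[]"])
    fix x
    have r: "size (lft y) \<le> size y" "size (rgt y) \<le> size y" for y
      by (cases y; simp)+
    show "size (h x) \<le> poly [:0, 1:] (size x)"
      using r[of x] r[of "rgt x"] by (auto simp: h_def)
    have v: "eval [e] [x] (Var 0) x 1" using eval_Var[of 0 "[x]"] by simp
    note l = eval_Lft[OF v] eval_Lft[OF eval_Rgt[OF v]] eval_Rgt[OF eval_Rgt[OF v]]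
    have "eval [e] [x] e (h x) ((1 + 1) + (1 + 1 + 1) + 1)"
    proof (cases "lft x = Lf")
      case True
      then show ?thesis unfolding e_def h_def
        using eval_If_False[OF l(1)[unfolded True] l(3)] by (simp add: e_def)
    next
      case False
      then show ?thesis unfolding e_def h_def
        using eval_If_True[OF l(1) False l(2)] by (simp add: e_def)
    qed
    then show "\<exists>t\<le>poly 6 (size x). eval [e] [x] e (h x) t"
      by (intro exI[of _ "(1 + 1) + (1 + 1 + 1) + 1"]) auto
  qed
  from ptime_comp[OF this ptime_Nd[OF assms(1) ptime_Nd[OF assms(2,3)]]]
  show ?thesis by (simp add: h_def cong: if_cong)
qed

section \<open>Testing trees for equality\<close>

fun veq :: "val \<Rightarrow> val \<Rightarrow> val" where
  "veq Lf Lf = Nd Lf Lf"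
| "veq (Nd a b) (Nd c d) = (if veq a c = Lf then Lf else veq b d)"
| "veq _ _ = Lf"

lemma veq_iff: "veq a b = (if a = b then Nd Lf Lf else Lf)"
  by (induction a b rule: veq.induct) auto

lemma ptime_veq: "ptime (\<lambda>z. veq (lft z) (rgt z))"
proof -
  define e where "e = If (Lft (Var 0))
    (If (Rgt (Var 0))
      (If (Call 0 [ENd (Lft (Lft (Var 0))) (Lft (Rgt (Var 0)))])
        (Call 0 [ENd (Rgt (Lft (Var 0))) (Rgt (Rgt (Var 0)))]) ELf) ELf)
    (If (Rgt (Var 0)) ELf (ENd ELf ELf))"
  have v: "eval [e] [x] (Var 0) x 1" for x using eval_Var[of 0 "[x]"] by simp
  have l: "eval [e] [Nd a b] (Lft (Var 0)) a 2" for a b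
    using eval_Lft[OF v[of "Nd a b"]] by (simp add: numeral_2_eq_2)
  have r: "eval [e] [Nd a b] (Rgt (Var 0)) b 2" for a b
    using eval_Rgt[OF v[of "Nd a b"]] by (simp add: numeral_2_eq_2)
  \<comment> \<open>Of the 60 steps charged for an inner node, 30 cover the constant term of the
    second recursive call and 30 the local overhead. The first argument alone bounds the cost, since
    the comparison ends as soon as either tree is exhausted.\<close>
  have ev: "\<exists>t \<le> 60 * size a + 30. eval [e] [Nd a b] e (veq a b) t" for a b
  proof (induction a b rule: veq.induct)
    case 1
    from eval_If_False[OF l[of Lf Lf] eval_If_False[OF r[of Lf Lf] eval_ENd[OF eval_ELf eval_ELf]]]
    show ?case by (intro exI[of _ "2 + (2 + (1 + 1 + 1) + 1) + 1"]) (auto simp: e_def)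
  next
    case (2 a b c d)
    let ?x = "Nd (Nd a b) (Nd c d)"
    let ?b = "If (Call 0 [ENd (Lft (Lft (Var 0))) (Lft (Rgt (Var 0)))])
        (Call 0 [ENd (Rgt (Lft (Var 0))) (Rgt (Rgt (Var 0)))]) ELf"
    from 2(1) obtain t1 where t1: "t1 \<le> 60 * size a + 30" "eval [e] [Nd a c] e (veq a c) t1" by blast
    have c1: "eval [e] [?x] (Call 0 [ENd (Lft (Lft (Var 0))) (Lft (Rgt (Var 0)))]) (veq a c)
      (((2 + 1) + (2 + 1) + 1) + t1 + 1)"
      using eval_ENd[OF eval_Lft[OF l[of "Nd a b" "Nd c d"]] eval_Lft[OF r[of "Nd a b" "Nd c d"]]] t1(2)
      by (intro eval_Call1[where x = "Nd a c"]) auto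
    have "\<exists>t \<le> t1 + 60 * size b + 30 + 17. eval [e] [?x] ?b (veq (Nd a b) (Nd c d)) t"
    proof (cases "veq a c = Lf")
      case True
      from eval_If_False[OF c1[unfolded True] eval_ELf] show ?thesis
        using True by (intro exI[of _ "(((2 + 1) + (2 + 1) + 1) + t1 + 1) + 1 + 1"]) auto
    next
      case False
      from 2(2)[OF False] obtain t2 where
        t2: "t2 \<le> 60 * size b + 30" "eval [e] [Nd b d] e (veq b d) t2" by blast
      have "eval [e] [?x] (Call 0 [ENd (Rgt (Lft (Var 0))) (Rgt (Rgt (Var 0)))]) (veq b d)
        (((2 + 1) + (2 + 1) + 1) + t2 + 1)"
        using eval_ENd[OF eval_Rgt[OF l[of "Nd a b" "Nd c d"]] eval_Rgt[OF r[of "Nd a b" "Nd c d"]]] t2(2)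
        by (intro eval_Call1[where x = "Nd b d"]) auto
      from eval_If_True[OF c1 False this] show ?thesis
        using False t2(1) by (intro exI[of _ "(((2 + 1) + (2 + 1) + 1) + t1 + 1) + (((2 + 1) + (2 + 1) + 1) + t2 + 1) + 1"]) auto
    qed
    then obtain t where t: "t \<le> t1 + 60 * size b + 30 + 17"
      "eval [e] [?x] ?b (veq (Nd a b) (Nd c d)) t" by blast
    have "eval [e] [?x] e (veq (Nd a b) (Nd c d)) (2 + (2 + t + 1) + 1)"
      unfolding e_def using eval_If_True[OF l[of "Nd a b" "Nd c d"] _ eval_If_True[OF r[of "Nd a b" "Nd c d"] _ t(2)]]
      by (simp only: e_def) simp
    then show ?case using t(1) t1(1) by (intro exI conjI) auto
  next
    case ("3_1" a b)
    from eval_If_True[OF l[of "Nd a b" Lf] _ eval_If_False[OF r[of "Nd a b" Lf] eval_ELf]]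
    show ?case by (intro exI[of _ "2 + (2 + 1 + 1) + 1"]) (auto simp: e_def)
  next
    case ("3_2" a b)
    from eval_If_False[OF l[of Lf "Nd a b"] eval_If_True[OF r[of Lf "Nd a b"] _ eval_ELf]]
    show ?case by (intro exI[of _ "2 + (2 + 1 + 1) + 1"]) (auto simp: e_def)
  qed
  \<comment> \<open>\<open>ev\<close> covers pairs only. On \<open>Lf\<close> both projections give
    \<open>Lf\<close>, so the separate case agrees with \<open>veq Lf Lf\<close>.\<close>
  have "ptime (\<lambda>x. if x = Lf then Nd Lf Lf else veq (lft x) (rgt x))"
  proof (rule ptimeI[where P = "[]" and e = e and p = 1 and q = "[:30, 60:]"])
    fix x
    show "size (if x = Lf then Nd Lf Lf else veq (lft x) (rgt x)) \<le> poly 1 (size x)"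
      by (auto simp: veq_iff)
    show "\<exists>t\<le>poly [:30, 60:] (size x). eval [e] [x] e (if x = Lf then Nd Lf Lf else veq (lft x) (rgt x)) t"
    proof (cases x)
      case Lf
      have ll: "eval [e] [Lf] (Lft (Var 0)) Lf 2" "eval [e] [Lf] (Rgt (Var 0)) Lf 2"
        using eval_Lft[OF v[of Lf]] eval_Rgt[OF v[of Lf]] by (auto simp: numeral_2_eq_2)
      from eval_If_False[OF ll(1) eval_If_False[OF ll(2) eval_ENd[OF eval_ELf eval_ELf]]]
      show ?thesis using Lf
        by (intro exI[of _ "2 + (2 + (1 + 1 + 1) + 1) + 1"]) (auto simp: e_def)
    next
      case (Nd a b)
      from ev[of a b] obtain t where "t \<le> 60 * size a + 30" "eval [e] [Nd a b] e (veq a b) t" by blast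
      then show ?thesis using Nd by (intro exI[of _ t]) auto
    qed
  qed
  moreover have "(\<lambda>x. if x = Lf then Nd Lf Lf else veq (lft x) (rgt x)) = (\<lambda>z. veq (lft z) (rgt z))"
    by (auto simp: fun_eq_iff veq_iff)
  ultimately show ?thesis by simp
qed

section \<open>Recursion along the right spine of a tree\<close>

primrec vrec :: "val \<Rightarrow> (val \<Rightarrow> val \<Rightarrow> val \<Rightarrow> val) \<Rightarrow> val \<Rightarrow> val" where
  "vrec i s Lf = i"
| "vrec i s (Nd a l) = s a l (vrec i s l)"

text \<open>This is limited recursion in the manner of Cobham: \<open>bound\<close> excludes, for
  instance, steps that double the recursive value and so produce trees of exponential size.\<close>

lemma ptime_vrec_aux:
  assumes i: "ptime i" and s: "ptime s"
    and bound: "\<And>c l. size (vrec (i c) (\<lambda>a l r. s (Nd c (Nd (Nd a l) r))) l) \<le> poly q (size c + size l)"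
  shows "ptime (\<lambda>w. vrec (i (lft w)) (\<lambda>a l r. s (Nd (lft w) (Nd (Nd a l) r))) (rgt w))"
proof -
  define R where "R c l = vrec (i c) (\<lambda>a l r. s (Nd c (Nd (Nd a l) r))) l" for c l
  from ptime_link[OF i, of 1] obtain Bi qi where
    bi: "\<And>A C. length A = 1 \<Longrightarrow> runs (A @ Bi @ C) 1 i qi" by blast
  from ptime_link[OF s, of "1 + length Bi"] obtain Bs qs where
    bs: "\<And>A C. length A = 1 + length Bi \<Longrightarrow> runs (A @ Bs @ C) (1 + length Bi) s qs" by blast
  define e where "e = If (Rgt (Var 0))
    (Call (1 + length Bi) [ENd (Lft (Var 0)) (ENd (Rgt (Var 0))
      (Call 0 [ENd (Lft (Var 0)) (Rgt (Rgt (Var 0)))]))])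
    (Call 1 [Lft (Var 0)])"
  define P where "P = e # Bi @ Bs"
  have ri: "runs P 1 i qi" using bi[of "[e]" Bs] by (simp add: P_def)
  have rs: "runs P (1 + length Bi) s qs" using bs[of "e # Bi" "[]"] by (simp add: P_def)
  have P0: "P ! 0 = e" "0 < length P" by (auto simp: P_def)
  have v: "eval P [x] (Var 0) x 1" for x using eval_Var[of 0 "[x]"] by simp
  have l: "eval P [x] (Lft (Var 0)) (lft x) 2" for x
    using eval_Lft[OF v[of x]] by (simp add: numeral_2_eq_2)
  have r: "eval P [x] (Rgt (Var 0)) (rgt x) 2" for x
    using eval_Rgt[OF v[of x]] by (simp add: numeral_2_eq_2)
  have rr: "eval P [x] (Rgt (Rgt (Var 0))) (rgt (rgt x)) 3" for x
    using eval_Rgt[OF r[of x]] by (simp add: numeral_3_eq_3)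
  \<comment> \<open>\<open>K\<close> bounds the cost of one level. The argument of \<open>s\<close>
    has two inner nodes of its own, data of size at most \<open>n\<close> and a recursive value of
    size at most \<open>poly q n\<close>; \<open>qi\<close> pays for the base case and 30 for the
    overhead.\<close>
  define K where "K = pcompose qs ([:2, 1:] + q) + qi + 30"
  \<comment> \<open>The bound \<open>n\<close> stays fixed while \<open>w\<close> shrinks, so every
    level is charged the same amount.\<close>
  have main: "\<exists>t \<le> (size (rgt w) + 1) * poly K n. eval P [w] e (R (lft w) (rgt w)) t"
    if "size (lft w) + size (rgt w) \<le> n" for w n
    using that
  proof (induction "rgt w" arbitrary: w)
    case Lf
    from runs_call[OF ri l[of w]] obtain t where t: "eval P [w] (Call 1 [Lft (Var 0)]) (i (lft w)) t"
      "t \<le> 2 + poly qi (size (lft w)) + 1" .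
    have "poly qi (size (lft w)) \<le> poly qi n"
      using Lf by (intro poly_nat_mono) simp
    moreover have "eval P [w] e (R (lft w) (rgt w)) (2 + t + 1)"
      unfolding e_def R_def using eval_If_False[OF r[of w, folded Lf(1)] t(1)] Lf(1) by (metis vrec.simps(1))
    ultimately show ?case using t(2) Lf(1)[symmetric] by (intro exI conjI) (auto simp: K_def)
  next
    case (Nd a l')
    let ?c = "lft w" and ?w = "Nd (lft w) l'"
    have "size (lft ?w) + size (rgt ?w) \<le> n" using Nd(3,4) by (simp flip: Nd(3))
    from Nd(2)[of ?w, simplified, OF this[simplified]] obtain t1 where
      t1: "t1 \<le> (size l' + 1) * poly K n" "eval P [?w] e (R ?c l') t1" by auto
    have rw: "rgt w = Nd a l'" using Nd(3) by simp
    have "eval P [w] (Call 0 [ENd (Lft (Var 0)) (Rgt (Rgt (Var 0)))]) (R ?c l') ((2 + 3 + 1) + t1 + 1)"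
      using rr[of w] l[of w] t1(2) P0
      by (intro eval_Call1[where x = "Nd ?c l'"]) (auto simp: rw intro: eval_ENd[of _ _ _ _ 2 _ _ 3, simplified])
    from eval_ENd[OF l[of w] eval_ENd[OF r[of w] this]] obtain t2 where
      t2: "eval P [w] (ENd (Lft (Var 0)) (ENd (Rgt (Var 0))
      (Call 0 [ENd (Lft (Var 0)) (Rgt (Rgt (Var 0)))]))) (Nd ?c (Nd (rgt w) (R ?c l'))) t2"
      "t2 \<le> t1 + 13" by fastforce
    from runs_call[OF rs t2(1)] obtain t3 where
      t3: "eval P [w] (Call (1 + length Bi) [ENd (Lft (Var 0)) (ENd (Rgt (Var 0))
      (Call 0 [ENd (Lft (Var 0)) (Rgt (Rgt (Var 0)))]))]) (s (Nd ?c (Nd (rgt w) (R ?c l')))) t3"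
      "t3 \<le> t2 + poly qs (size (Nd ?c (Nd (rgt w) (R ?c l')))) + 1" .
    have "eval P [w] e (R ?c (rgt w)) (2 + t3 + 1)"
      unfolding e_def using eval_If_True[OF r[of w] _ t3(1)] rw by (simp add: R_def)
    moreover
    have "size (R ?c l') \<le> poly q n"
      using bound[of ?c l'] poly_nat_mono[of "size ?c + size l'" n q] Nd(4) rw by (simp add: R_def)
    then have "size (Nd ?c (Nd (rgt w) (R ?c l'))) \<le> poly ([:2, 1:] + q) n"
      using Nd(4) by simp
    then have "poly qs (size (Nd ?c (Nd (rgt w) (R ?c l')))) \<le> poly qs (poly ([:2, 1:] + q) n)"
      by (rule poly_nat_mono)
    then have "2 + t3 + 1 \<le> t1 + poly K n"
      using t3(2) t2(2) unfolding K_def poly_add poly_pcompose by simp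
    then have "2 + t3 + 1 \<le> (size (rgt w) + 1) * poly K n"
      using t1(1) by (simp add: rw algebra_simps)
    ultimately show ?case by blast
  qed
  have szr: "size (lft w) + size (rgt w) \<le> size w" for w by (cases w) auto
  show ?thesis
  proof (rule ptimeI[where e = e and P = "Bi @ Bs" and p = q and q = "[:1, 1:] * K"])
    fix w
    show "size (vrec (i (lft w)) (\<lambda>a l r. s (Nd (lft w) (Nd (Nd a l) r))) (rgt w)) \<le> poly q (size w)"
      using bound[of "lft w" "rgt w"] poly_nat_mono[OF szr[of w], of q] by simp
    from main[OF szr[of w]] obtain t where t: "t \<le> (size (rgt w) + 1) * poly K (size w)"
      "eval P [w] e (R (lft w) (rgt w)) t" by blast
    have "(size (rgt w) + 1) * poly K (size w) \<le> (size w + 1) * poly K (size w)"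
      using szr[of w] by (intro mult_right_mono) auto
    with t(1) have "t \<le> (size w + 1) * poly K (size w)" by (rule order_trans)
    with t(2) show "\<exists>t\<le>poly ([:1, 1:] * K) (size w). eval (e # Bi @ Bs) [w] e
      (vrec (i (lft w)) (\<lambda>a l r. s (Nd (lft w) (Nd (Nd a l) r))) (rgt w)) t"
      unfolding R_def P_def by (intro exI[of _ t]) simp
  qed
qed

lemma ptime_vrec:
  assumes "ptime i" "ptime l"
    and s: "ptime (\<lambda>w. s (lft w) (lft (lft (rgt w))) (rgt (lft (rgt w))) (rgt (rgt w)))"
    and bound: "\<And>c l. size (vrec (i c) (s c) l) \<le> poly q (size c + size l)"
  shows "ptime (\<lambda>z. vrec (i z) (s z) (l z))"
proof -
  have "ptime (\<lambda>w. vrec (i (lft w)) (s (lft w)) (rgt w))"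
    using ptime_vrec_aux[OF assms(1) s, of q] bound by simp
  from ptime_comp[OF this ptime_Nd[OF ptime_id assms(2)]] show ?thesis by simp
qed

section \<open>Truth values, lists and unary numbers as trees\<close>

definition bool_val :: "bool \<Rightarrow> val" where
  "bool_val b = (if b then Nd Lf Lf else Lf)"

abbreviation ptimeb :: "(val \<Rightarrow> bool) \<Rightarrow> bool" where
  "ptimeb P \<equiv> ptime (\<lambda>z. bool_val (P z))"

abbreviation ptimel :: "(val \<Rightarrow> val list) \<Rightarrow> bool" where
  "ptimel l \<equiv> ptime (\<lambda>z. list_val (l z))"

text \<open>Every tree is the value of exactly one list, so lists need no well-formedness condition
  and any input can be processed as a list.\<close>

primrec list_of :: "val \<Rightarrow> val list" where
  "list_of Lf = []"
| "list_of (Nd a b) = a # list_of b"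

lemma list_of_list_val [simp]: "list_of (list_val xs) = xs"
  by (induction xs) auto

lemma list_val_list_of [simp]: "list_val (list_of v) = v"
  by (induction v) auto

lemma list_val_inject [simp]: "list_val xs = list_val ys \<longleftrightarrow> xs = ys"
  by (metis list_of_list_val)

lemma list_val_eq_Lf [simp]: "list_val xs = Lf \<longleftrightarrow> xs = []"
  by (cases xs) auto

lemma size_list_val: "size (list_val xs) = (\<Sum>x\<leftarrow>xs. size x + 1)"
  by (induction xs) auto

lemma size_list_val_append: "size (list_val (xs @ ys)) = size (list_val xs) + size (list_val ys)"
  by (simp add: size_list_val)

lemma length_le_size_list_val: "length xs \<le> size (list_val xs)"
  by (induction xs) auto

lemma size_mem_list_val: "x \<in> set xs \<Longrightarrow> size x \<le> size (list_val xs)"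
  by (induction xs) auto

text \<open>Unary notation suffices for times and counts, which are polynomially bounded, and
  reduces arithmetic to operations on lists.\<close>

definition nv :: "nat \<Rightarrow> val" where
  "nv n = list_val (replicate n Lf)"

lemma nv_inject [simp]: "nv m = nv n \<longleftrightarrow> m = n"
  by (simp add: nv_def)

lemma nv_0 [simp]: "nv 0 = Lf"
  by (simp add: nv_def)

lemma nv_Suc: "nv (Suc n) = Nd Lf (nv n)"
  by (simp add: nv_def)

lemma nv_eq_Lf [simp]: "nv n = Lf \<longleftrightarrow> n = 0"
  by (simp add: nv_def)

lemma size_nv [simp]: "size (nv n) = n"
  by (induction n) (auto simp: nv_Suc)

abbreviation ptimen :: "(val \<Rightarrow> nat) \<Rightarrow> bool" where
  "ptimen f \<equiv> ptime (\<lambda>z. nv (f z))"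

subsection \<open>Booleans\<close>

lemma ptime_eq: "ptime f \<Longrightarrow> ptime g \<Longrightarrow> ptimeb (\<lambda>z. f z = g z)"
  using ptime_comp[OF ptime_veq ptime_Nd, of f g] by (simp add: veq_iff bool_val_def)

lemma ptime_if: 
  assumes "ptimeb c" "ptime f" "ptime g"
  shows "ptime (\<lambda>z. if c z then f z else g z)"
proof -
  have "(\<lambda>z. if bool_val (c z) = Lf then g z else f z) = (\<lambda>z. if c z then f z else g z)"
    by (auto simp: bool_val_def)
  with ptime_If_Lf[OF assms] show ?thesis by simp
qed

lemma ptimeb_not: 
  assumes "ptimeb P"
  shows "ptimeb (\<lambda>z. \<not> P z)"
proof -
  have "(\<lambda>z. if P z then Lf else Nd Lf Lf) = (\<lambda>z. bool_val (\<not> P z))"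
    by (auto simp: bool_val_def)
  with ptime_if[OF assms ptime_Lf ptime_const[of "Nd Lf Lf"]] show ?thesis by simp
qed

lemma ptimeb_conj:
  assumes "ptimeb P" "ptimeb Q"
  shows "ptimeb (\<lambda>z. P z \<and> Q z)"
proof -
  have "(\<lambda>z. if P z then bool_val (Q z) else Lf) = (\<lambda>z. bool_val (P z \<and> Q z))"
    by (auto simp: bool_val_def)
  with ptime_if[OF assms(1,2) ptime_Lf] show ?thesis by simp
qed

lemma ptimeb_disj:
  assumes "ptimeb P" "ptimeb Q"
  shows "ptimeb (\<lambda>z. P z \<or> Q z)"
proof -
  have "ptimeb (\<lambda>z. \<not> (\<not> P z \<and> \<not> Q z))"
    by (intro ptimeb_not ptimeb_conj assms)
  then show ?thesis by simp
qed

lemma ptimeb_imp: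
  assumes "ptimeb P" "ptimeb Q"
  shows "ptimeb (\<lambda>z. P z \<longrightarrow> Q z)"
proof -
  have "ptimeb (\<lambda>z. \<not> P z \<or> Q z)"
    by (intro ptimeb_not ptimeb_disj assms)
  then show ?thesis by simp
qed

lemma ptimeb_const: "ptimeb (\<lambda>z. b)"
  by (rule ptime_const)

text \<open>As \<open>n\<close> is a constant, this is a conjunction of \<open>n\<close> separate
  programs, in each of which the index is a constant too.\<close>

lemma ptimeb_all_less:
  fixes n :: nat
  assumes "\<And>i. i < n \<Longrightarrow> ptimeb (\<lambda>z. P z i)"
  shows "ptimeb (\<lambda>z. \<forall>i<n. P z i)"
  using assms
proof (induction n)
  case (Suc n)
  then have "ptimeb (\<lambda>z. (\<forall>i<n. P z i) \<and> P z n)" by (intro ptimeb_conj) auto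
  then show ?case by (simp add: All_less_Suc conj_commute)
qed (simp add: ptimeb_const)

subsection \<open>Lists\<close>

lemma foldr_eq_vrec: "foldr s xs i = vrec i (\<lambda>a t. s a) (list_val xs)"
  by (induction xs) auto

lemma ptime_foldr:
  assumes "ptimel l" "ptime i" "ptime (\<lambda>w. s (lft w) (lft (rgt w)) (rgt (rgt w)))"
    and bound: "\<And>c xs. size (foldr (s c) xs (i c)) \<le> poly q (size c + size (list_val xs))"
  shows "ptime (\<lambda>z. foldr (s z) (l z) (i z))"
  unfolding foldr_eq_vrec
proof (rule ptime_vrec[where i = i and l = "\<lambda>z. list_val (l z)" and s = "\<lambda>z a t r. s z a r"])
  show "size (vrec (i c) (\<lambda>a t. s c a) l) \<le> poly q (size c + size l)" for c l
    using bound[of c "list_of l"] by (simp add: foldr_eq_vrec)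
  have "ptime (\<lambda>w. Nd (lft w) (Nd (lft (lft (rgt w))) (rgt (rgt w))))"
    by (intro ptime_Nd ptime_lft ptime_rgt ptime_id)
  from ptime_comp[OF assms(3) this]
  show "ptime (\<lambda>w. s (lft w) (lft (lft (rgt w))) (rgt (rgt w)))" by simp
qed fact+

lemma ptimel_list_of: "ptime f \<Longrightarrow> ptimel (\<lambda>z. list_of (f z))"
  by simp

lemma ptimel_Nil: "ptimel (\<lambda>z. [])"
  by (simp add: ptime_Lf)

lemma ptimel_Cons: "ptime f \<Longrightarrow> ptimel l \<Longrightarrow> ptimel (\<lambda>z. f z # l z)"
  by (simp add: ptime_Nd)

lemma ptimel_append:
  assumes "ptimel l" "ptimel m"
  shows "ptimel (\<lambda>z. l z @ m z)"
proof -
  have *: "foldr Nd xs (list_val ys) = list_val (xs @ ys)" for xs ys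
    by (induction xs) auto
  have "ptime (\<lambda>w. foldr Nd (list_of (lft w)) (rgt w))"
  proof (rule ptime_foldr[where q = "[:0, 1:]" and s = "\<lambda>_. Nd"])
    fix c xs
    have "size (list_val (xs @ list_of (rgt c))) \<le> size c + size (list_val xs)"
      by (cases c) (auto simp: size_list_val_append)
    then show "size (foldr Nd xs (rgt c)) \<le> poly [:0, 1:] (size c + size (list_val xs))"
      using *[of xs "list_of (rgt c)"] by simp
  qed (intro ptimel_list_of ptime_Nd ptime_lft ptime_rgt ptime_id)+
  from ptime_comp[OF this ptime_Nd[OF assms]] show ?thesis by (simp add: *)
qed

text \<open>Mapping, filtering and bounded quantification all reduce to this combinator. Its result
  is bounded by the number of pieces times a common bound for the size of a piece.\<close>

lemma ptimel_concat_map: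
  assumes l: "ptimel l" and g: "ptimel (\<lambda>w. g (lft w) (rgt w))"
  shows "ptimel (\<lambda>z. concat (map (g z) (l z)))"
proof -
  define s where "s c a r = list_val (g c a @ list_of r)" for c a r
  have eq: "foldr (s c) xs Lf = list_val (concat (map (g c) xs))" for c xs
    by (induction xs) (auto simp: s_def)
  from g obtain q where q: "size (list_val (g (lft w) (rgt w))) \<le> poly q (size w)" for w
    unfolding ptime_def runs_def by blast
  have "ptime (\<lambda>z. foldr (s z) (l z) Lf)"
  proof (rule ptime_foldr[OF l ptime_Lf, where q = "[:0, 1:] * pcompose q [:1, 1:]"])
    have "ptimel (\<lambda>w. g (lft w) (lft (rgt w)))"
      using ptime_comp[OF g ptime_Nd, of lft "\<lambda>w. lft (rgt w)"]
      by (simp add: ptime_lft ptime_rgt ptime_id)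
    then show "ptime (\<lambda>w. s (lft w) (lft (rgt w)) (rgt (rgt w)))" unfolding s_def
      by (intro ptimel_append ptimel_list_of ptime_rgt ptime_id)
    fix c xs
    \<comment> \<open>Stated for all lists \<open>ys\<close> over the members of \<open>xs\<close>,
      so that the bound, which mentions \<open>xs\<close>, does not change during the
      induction.\<close>
    have "size (list_val (concat (map (g c) ys))) \<le> length ys * poly q (size c + size (list_val xs) + 1)"
      if "set ys \<subseteq> set xs" for ys
      using that
    proof (induction ys)
      case (Cons y ys)
      have "size y \<le> size (list_val xs)" using Cons.prems by (intro size_mem_list_val) simp
      then have "poly q (size (Nd c y)) \<le> poly q (size c + size (list_val xs) + 1)"
        by (intro poly_nat_mono) simp
      with q[of "Nd c y"] Cons show ?case by (simp add: size_list_val_append)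
    qed simp
    from this[of xs] have "size (list_val (concat (map (g c) xs))) \<le> length xs * poly q (size c + size (list_val xs) + 1)"
      by simp
    also have "\<dots> \<le> (size c + size (list_val xs)) * poly q (size c + size (list_val xs) + 1)"
      using length_le_size_list_val[of xs] by (intro mult_right_mono) auto
    finally show "size (foldr (s c) xs Lf) \<le> poly ([:0, 1:] * pcompose q [:1, 1:]) (size c + size (list_val xs))"
      by (simp add: eq poly_pcompose algebra_simps)
  qed
  then show ?thesis by (simp add: eq)
qed

lemma ptimel_if:
  assumes "ptimeb c" "ptimel f" "ptimel g"
  shows "ptimel (\<lambda>z. if c z then f z else g z)"
  using ptime_if[OF assms] by (simp add: if_distrib[of list_val])

lemma ptimel_map:
  assumes "ptimel l" "ptime (\<lambda>w. f (lft w) (rgt w))"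
  shows "ptimel (\<lambda>z. map (f z) (l z))"
proof -
  have "map (f z) xs = concat (map (\<lambda>a. [f z a]) xs)" for z xs
    by (induction xs) auto
  moreover have "ptimel (\<lambda>z. concat (map (\<lambda>a. [f z a]) (l z)))"
    by (intro ptimel_concat_map assms ptimel_Cons ptimel_Nil)
  ultimately show ?thesis by simp
qed

lemma ptimel_filter:
  assumes "ptimel l" "ptimeb (\<lambda>w. P (lft w) (rgt w))"
  shows "ptimel (\<lambda>z. filter (P z) (l z))"
proof -
  have "filter (P z) xs = concat (map (\<lambda>a. if P z a then [a] else []) xs)" for z xs
    by (induction xs) auto
  moreover have "ptimel (\<lambda>z. concat (map (\<lambda>a. if P z a then [a] else []) (l z)))"
    by (intro ptimel_concat_map ptimel_if assms ptimel_Cons ptimel_Nil ptime_rgt ptime_id)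
  ultimately show ?thesis by simp
qed

lemma ptimeb_Ball:
  assumes "ptimel l" "ptimeb (\<lambda>w. P (lft w) (rgt w))"
  shows "ptimeb (\<lambda>z. \<forall>a\<in>set (l z). P z a)"
proof -
  have "ptimeb (\<lambda>z. list_val (filter (\<lambda>a. \<not> P z a) (l z)) = Lf)"
    by (intro ptime_eq ptimel_filter ptimeb_not assms ptime_Lf)
  then show ?thesis by (simp add: filter_empty_conv)
qed

lemma ptimeb_Bex:
  assumes "ptimel l" "ptimeb (\<lambda>w. P (lft w) (rgt w))"
  shows "ptimeb (\<lambda>z. \<exists>a\<in>set (l z). P z a)"
proof -
  have "ptimeb (\<lambda>z. \<not> (\<forall>a\<in>set (l z). \<not> P z a))"
    by (intro ptimeb_not ptimeb_Ball assms)
  then show ?thesis by simp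
qed

lemma ptimeb_mem: 
  assumes "ptime f" "ptimel l"
  shows "ptimeb (\<lambda>z. f z \<in> set (l z))"
proof -
  have "ptimeb (\<lambda>z. \<exists>a\<in>set (l z). a = f z)"
    using assms ptime_comp[OF assms(1) ptime_lft[OF ptime_id]]
    by (intro ptimeb_Bex ptime_eq ptime_rgt ptime_id)
  then show ?thesis by simp
qed

lemma ptimeb_list_eq: "ptimel l \<Longrightarrow> ptimel m \<Longrightarrow> ptimeb (\<lambda>z. l z = m z)"
  using ptime_eq[of "\<lambda>z. list_val (l z)" "\<lambda>z. list_val (m z)"] by simp

text \<open>Polynomial because the exponent \<open>n\<close> is a constant. In the procedure it is
  \<open>k\<close>, \<open>k - 1\<close> or the length of a timetable.\<close>

lemma ptimel_n_lists:
  assumes "ptimel l"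
  shows "ptimel (\<lambda>z. map list_val (List.n_lists n (l z)))"
proof (induction n)
  case 0
  show ?case by (simp add: ptime_const)
next
  case (Suc n)
  have "map list_val (List.n_lists (Suc n) xs) =
      concat (map (\<lambda>y. map (\<lambda>x. Nd x y) xs) (map list_val (List.n_lists n xs)))" for xs
    by (simp add: map_concat comp_def)
  moreover have "ptimel (\<lambda>z. concat (map (\<lambda>y. map (\<lambda>x. Nd x y) (l z)) (map list_val (List.n_lists n (l z)))))"
    by (intro ptimel_concat_map Suc ptimel_map ptime_comp[OF assms] ptime_Nd ptime_lft ptime_rgt ptime_id)
  ultimately show ?case by simp
qed

subsection \<open>Unary numbers\<close>

lemma ptimen_length: "ptimel l \<Longrightarrow> ptimen (\<lambda>z. length (l z))"
  using ptimel_map[OF _ ptime_Lf, of l] by (simp add: nv_def map_replicate_const)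

lemma ptimen_if: "ptimeb c \<Longrightarrow> ptimen f \<Longrightarrow> ptimen g \<Longrightarrow> ptimen (\<lambda>z. if c z then f z else g z)"
  using ptime_if[of c "\<lambda>z. nv (f z)" "\<lambda>z. nv (g z)"] by (simp add: if_distrib[of nv])

lemma ptimen_eq: "ptimen f \<Longrightarrow> ptimen g \<Longrightarrow> ptimeb (\<lambda>z. f z = g z)"
  using ptime_eq[of "\<lambda>z. nv (f z)" "\<lambda>z. nv (g z)"] by simp

lemma ptimen_add: "ptimen f \<Longrightarrow> ptimen g \<Longrightarrow> ptimen (\<lambda>z. f z + g z)"
  using ptimel_append[of "\<lambda>z. replicate (f z) Lf" "\<lambda>z. replicate (g z) Lf"]
  by (simp add: nv_def replicate_add)

lemma ptimen_diff:
  assumes "ptimen f" "ptimen g"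
  shows "ptimen (\<lambda>z. f z - g z)"
proof -
  have r: "rgt (nv m) = nv (m - 1)" for m by (cases m) (auto simp: nv_Suc)
  \<comment> \<open>The fold over the unary subtrahend is a loop that removes one node per round;
    truncation comes from \<open>rgt Lf = Lf\<close>.\<close>
  have *: "foldr (\<lambda>_ r. rgt r) (list_of (nv n)) (nv m) = nv (m - n)" for n m
    by (induction n) (auto simp: nv_Suc r)
  have "ptime (\<lambda>w. foldr (\<lambda>_ r. rgt r) (list_of (rgt w)) (lft w))"
  proof (rule ptime_foldr[where q = "[:0, 1:]" and s = "\<lambda>_ _ r. rgt r"])
    fix c and xs :: "val list"
    have r: "size (rgt y) \<le> size y" for y by (cases y; simp)
    have "size (foldr (\<lambda>_ r. rgt r) xs (lft c)) \<le> size c"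
    proof (induction xs)
      case (Cons x xs) then show ?case using r by (auto intro: order_trans)
    qed (cases c; simp)
    then show "size (foldr (\<lambda>_ r. rgt r) xs (lft c)) \<le> poly [:0, 1:] (size c + size (list_val xs))"
      by simp
  qed (intro ptimel_list_of ptime_lft ptime_rgt ptime_id)+
  from ptime_comp[OF this ptime_Nd[OF assms]] show ?thesis
    by (simp add: *)
qed

lemma ptimen_const: "ptimen (\<lambda>z. n)"
  by (rule ptime_const)

lemma ptimen_less:
  assumes "ptimen f" "ptimen g"
  shows "ptimeb (\<lambda>z. f z < g z)"
proof -
  have "ptimeb (\<lambda>z. \<not> g z - f z = 0)"
    by (intro ptimeb_not ptimen_eq ptimen_diff ptimen_const assms)
  then show ?thesis by (simp add: not_le)
qed

lemma ptimel_upt: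
  assumes "ptimen f"
  shows "ptimel (\<lambda>z. map nv [0..<f z])"
proof -
  let ?s = "\<lambda>_ r. list_val (list_of r @ [nv (length (list_of r))])"
  have *: "foldr ?s xs Lf = list_val (map nv [0..<length xs])" for xs :: "val list"
    by (induction xs) auto
  have "ptime (\<lambda>z. foldr ?s (list_of (nv (f z))) Lf)"
  proof (rule ptime_foldr[where q = "[:0, 1, 1:]" and s = "\<lambda>_. ?s"])
    fix c :: val and xs :: "val list"
    have "size (list_val (map nv [0..<n])) \<le> n * n + n" for n
      by (induction n) (auto simp: size_list_val_append)
    from this[of "length xs"] have "size (list_val (map nv [0..<length xs])) \<le> length xs * length xs + length xs" .
    also have "\<dots> \<le> (size c + size (list_val xs)) * (size c + size (list_val xs)) + (size c + size (list_val xs))"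
      using length_le_size_list_val[of xs] by (intro add_mono mult_mono) auto
    finally show "size (foldr ?s xs Lf) \<le> poly [:0, 1, 1:] (size c + size (list_val xs))"
      unfolding * by (simp add: algebra_simps)
  qed (intro ptimel_append ptimel_list_of ptimel_Cons ptimel_Nil ptimen_length ptime_rgt ptime_id ptime_Lf assms)+
  then show ?thesis unfolding * by (simp add: nv_def)
qed

subsection \<open>Binary numbers\<close>

text \<open>Addition of 1 with the least significant bit first: \<open>l\<close> is the tail without
  a carry and \<open>r\<close> the tail with a carry, which is why \<open>vrec\<close> hands over
  both.\<close>

definition binc :: "val \<Rightarrow> val" where
  "binc = vrec (Nd (Nd Lf Lf) Lf) (\<lambda>a l r. if a = Lf then Nd (Nd Lf Lf) l else Nd Lf r)"

lemma nat_val_0 [simp]: "nat_val 0 = Lf"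
  by (simp add: nat_val.simps)

lemma nat_val_eq_Lf [simp]: "nat_val n = Lf \<longleftrightarrow> n = 0" "Lf = nat_val n \<longleftrightarrow> n = 0"
  by (subst nat_val.simps; simp)+

lemma nat_val_pos: "n > 0 \<Longrightarrow> nat_val n = Nd (if odd n then Nd Lf Lf else Lf) (nat_val (n div 2))"
  by (subst nat_val.simps) simp

lemma binc_nat_val: "binc (nat_val n) = nat_val (Suc n)"
proof (induction n rule: less_induct)
  case (less n)
  show ?case
  proof (cases "n = 0")
    case True
    then show ?thesis by (simp add: binc_def nat_val_pos)
  next
    case False
    with less[of "n div 2"] have "binc (nat_val (n div 2)) = nat_val (Suc (n div 2))" by simp
    with False show ?thesis
      by (simp add: nat_val_pos[of n] nat_val_pos[of "Suc n"]) (auto simp: binc_def)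
  qed
qed

lemma size_binc: "size (binc x) \<le> size x + 2"
  unfolding binc_def by (induction x) auto

lemma ptime_binc: "ptime f \<Longrightarrow> ptime (\<lambda>z. binc (f z))"
  unfolding binc_def
proof (rule ptime_vrec[where q = "[:2, 1:]"])
  show "size (vrec (Nd (Nd Lf Lf) Lf) (\<lambda>a l r. if a = Lf then Nd (Nd Lf Lf) l else Nd Lf r) l)
      \<le> poly [:2, 1:] (size c + size l)" for c l :: val
    using size_binc[of l] by (simp add: binc_def)
qed (intro ptime_if ptime_eq ptime_const ptime_lft ptime_rgt ptime_id ptime_Nd | assumption)+

text \<open>Counting up from zero. The converse conversion can be exponential, so values of
  \<open>f\<close> and \<open>g\<close> in the input are compared with codes of small numbers
  instead.\<close>

lemma ptime_nat_val:
  assumes "ptimen f"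
  shows "ptime (\<lambda>z. nat_val (f z))"
proof -
  have *: "foldr (\<lambda>_. binc) xs Lf = nat_val (length xs)" for xs :: "val list"
    by (induction xs) (auto simp: binc_nat_val)
  have "ptime (\<lambda>z. foldr (\<lambda>_. binc) (list_of (nv (f z))) Lf)"
  proof (rule ptime_foldr[where q = "[:0, 2:]" and s = "\<lambda>_ _. binc"])
    fix c :: val and xs :: "val list"
    have "size (foldr (\<lambda>_. binc) xs Lf) \<le> 2 * length xs"
    proof (induction xs)
      case (Cons x xs)
      then show ?case using size_binc[of "foldr (\<lambda>_. binc) xs Lf"] by simp
    qed simp
    then show "size (foldr (\<lambda>_. binc) xs Lf) \<le> poly [:0, 2:] (size c + size (list_val xs))"
      using length_le_size_list_val[of xs] by simp
  qed (intro ptimel_list_of ptime_binc ptime_rgt ptime_id ptime_Lf assms)+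
  then show ?thesis unfolding * by (simp add: nv_def)
qed

lemma nat_val_inject [simp]: "nat_val m = nat_val n \<longleftrightarrow> m = n"
proof (induction m arbitrary: n rule: less_induct)
  case (less m)
  show ?case
  proof
    assume eq: "nat_val m = nat_val n"
    show "m = n"
    proof (cases "m = 0 \<or> n = 0")
      case True
      with eq show ?thesis by auto
    next
      case False
      then have "nat_val (m div 2) = nat_val (n div 2)" "odd m = odd n"
        using eq by (auto simp: nat_val_pos split: if_splits)
      with less[of "m div 2" "n div 2"] False have "m div 2 = n div 2" "odd m = odd n" by auto
      then show ?thesis by presburger
    qed
  qed simp
qed

section \<open>The decision procedure\<close>

lemma ptimel_map_nat_val:
  assumes "ptimen f"
  shows "ptimel (\<lambda>z. map nat_val [0..<f z])"
proof -
  have "ptimel (\<lambda>z. map (\<lambda>v. nat_val (length (list_of v))) (map nv [0..<f z]))"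
    by (intro ptimel_map ptimel_upt assms ptime_nat_val ptimen_length ptimel_list_of ptime_rgt ptime_id)
  then show ?thesis by (simp add: comp_def nv_def)
qed

lemma ptimeb_nats_eq:
  assumes "ptimel (\<lambda>z. map nv (p z))" "ptimel (\<lambda>z. map nv (q z))"
  shows "ptimeb (\<lambda>z. p z = q z)"
proof -
  have "inj nv" by (simp add: inj_on_def)
  then have "map nv xs = map nv ys \<longleftrightarrow> xs = ys" for xs ys by (simp add: inj_map_eq_map)
  with ptimeb_list_eq[OF assms] show ?thesis by simp
qed

text \<open>The default 0 is what projections give beyond the end of a list: they yield
  \<open>Lf\<close>, which is \<open>nv 0\<close>.\<close>

definition nth0 :: "nat list \<Rightarrow> nat \<Rightarrow> nat" where
  "nth0 p i = (if i < length p then p ! i else 0)"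

lemma ptimen_nth0:
  assumes "ptimel (\<lambda>z. map nv (p z))"
  shows "ptimen (\<lambda>z. nth0 (p z) i)"
proof -
  have "(rgt ^^ i) (list_val xs) = list_val (drop i xs)" for xs
  proof (induction i)
    case (Suc i)
    have "rgt (list_val ys) = list_val (tl ys)" for ys by (cases ys) auto
    with Suc show ?case by (simp add: drop_Suc tl_drop)
  qed simp
  then have "nv (nth0 p i) = lft ((rgt ^^ i) (list_val (map nv p)))" for p
    by (cases "i < length p") (auto simp: nth0_def simp flip: Cons_nth_drop_Suc)
  moreover have "ptime (\<lambda>z. (rgt ^^ i) (list_val (map nv (p z))))"
    by (induction i) (auto intro: assms ptime_rgt)
  ultimately show ?thesis by (simp add: ptime_lft)
qed

lemma ptimen_length_nats: "ptimel (\<lambda>z. map nv (p z)) \<Longrightarrow> ptimen (\<lambda>z. length (p z))"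
  using ptimen_length[of "\<lambda>z. map nv (p z)"] by simp

lemmas ptime_intros = ptime_id ptime_lft ptime_rgt ptime_Nd ptime_const ptime_eq ptime_if
  ptimeb_not ptimeb_conj ptimeb_disj ptimeb_imp ptimeb_all_less ptimeb_Ball ptimeb_Bex ptimeb_mem
  ptimel_list_of ptimel_map ptimel_filter ptimel_concat_map ptimel_n_lists ptimel_upt
  ptimen_length ptimen_if ptimen_eq ptimen_less ptimen_add ptimen_diff ptimen_nth0 ptimen_length_nats
  ptime_nat_val ptimel_map_nat_val ptimeb_nats_eq

text \<open>The selectors pick the first, third, eighth and ninth entries of an instance; arcs of
  the graph are obtained as the keys of the table of \<open>f\<close>.\<close>

definition in_verts :: "val \<Rightarrow> val list" where
  "in_verts x = list_of (lft x)"

definition in_root :: "val \<Rightarrow> val" where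
  "in_root x = lft (rgt (rgt x))"

definition in_f :: "val \<Rightarrow> val list" where
  "in_f x = list_of (lft (rgt (rgt (rgt (rgt (rgt (rgt (rgt x))))))))"

definition in_g :: "val \<Rightarrow> val list" where
  "in_g x = list_of (lft (rgt (rgt (rgt (rgt (rgt (rgt (rgt (rgt x)))))))))"

lemma ptimel_in:
  assumes "ptime x"
  shows "ptimel (\<lambda>z. in_verts (x z))" "ptime (\<lambda>z. in_root (x z))"
    "ptimel (\<lambda>z. in_f (x z))" "ptimel (\<lambda>z. in_g (x z))"
  unfolding in_verts_def in_root_def in_f_def in_g_def by (intro ptime_intros assms)+

text \<open>The value is \<open>0\<close> if \<open>b\<close> is not the code of a number of at most \<open>n\<close>.\<close>

primrec unary_upto :: "nat \<Rightarrow> val \<Rightarrow> nat" where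
  "unary_upto 0 b = 0"
| "unary_upto (Suc n) b = (if b = nat_val (Suc n) then Suc n else unary_upto n b)"

lemma unary_upto_nat_val: "m \<le> n \<Longrightarrow> unary_upto n (nat_val m) = m"
  by (induction n) (auto simp: le_Suc_eq)

lemma ptimen_unary_upto: "ptime b \<Longrightarrow> ptimen (\<lambda>z. unary_upto n (b z))"
  by (induction n) (auto intro!: ptime_intros simp del: nv_0 simp: ptime_const)

text \<open>On encoded instances this is the length of every solution. It is polynomially bounded
  because each summand is at most \<open>F\<close>.\<close>

definition walk_length :: "nat \<Rightarrow> val \<Rightarrow> nat" where
  "walk_length F x = (\<Sum>a\<leftarrow>in_f x. unary_upto F (rgt a))"

lemma ptimen_walk_length:
  assumes "ptime x"
  shows "ptimen (\<lambda>z. walk_length F (x z))"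
proof -
  have "ptimen (\<lambda>z. length (concat (map (\<lambda>a. list_of (nv (unary_upto F (rgt a)))) (in_f (x z)))))"
    by (intro ptime_intros ptimen_unary_upto ptimel_in assms)
  then show ?thesis by (simp add: walk_length_def length_concat comp_def nv_def)
qed

text \<open>
  A timetable \<open>S\<close> is a list of pairs of a time in unary and an arc, padded with \<open>Lf\<close> to a fixed
  length.
\<close>

definition times :: "nat \<Rightarrow> val \<Rightarrow> val \<Rightarrow> nat list" where
  "times L S e = filter (\<lambda>t. Nd (nv t) e \<in> set (list_of S)) [0..<L]"

text \<open>This is \<open>steps_between\<close> with the length of the walk and the list of
  traversal times as parameters, made total by \<open>nth0\<close>.\<close>

definition gap :: "nat \<Rightarrow> nat list \<Rightarrow> nat \<Rightarrow> nat" where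
  "gap L p y = (if y < length p then nth0 p y - nth0 p (y - 1) - 1
     else L + nth0 p 0 - nth0 p (y - 1) - 1)"

text \<open>
  The values of \<open>g\<close> are binary and can be exponentially large; a gap is at most \<open>g\<close> iff \<open>g\<close> is none
  of the polynomially many numbers below the gap.
\<close>

definition arc_ok :: "nat \<Rightarrow> val \<Rightarrow> nat list \<Rightarrow> val \<Rightarrow> val \<Rightarrow> bool" where
  "arc_ok F x p e fe \<longleftrightarrow> nat_val (length p) = fe \<and>
     (\<forall>i<F. i < length p \<longrightarrow> (\<forall>c\<in>set (in_g x). lft c = Nd e (nat_val (Suc i)) \<longrightarrow>
        rgt c \<notin> set (map nat_val [0..<gap (walk_length F x) p (Suc i)])))"

definition incident :: "val \<Rightarrow> val \<Rightarrow> bool" where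
  "incident e v \<longleftrightarrow> lft e = v \<or> rgt e = v"

text \<open>An entry \<open>q\<close> has time \<open>lft q\<close>, arc tail
  \<open>lft (rgt q)\<close> and arc head \<open>rgt (rgt q)\<close>; the test
  \<open>q \<noteq> Lf\<close> skips padding. In unary, \<open>Nd Lf\<close> is the successor, which
  is reset to \<open>Lf\<close>, that is 0, at the walk length.\<close>

definition vertex_ok :: "nat \<Rightarrow> val \<Rightarrow> val \<Rightarrow> val \<Rightarrow> bool" where
  "vertex_ok F x v S \<longleftrightarrow>
     (\<forall>a\<in>set (in_f x). incident (lft a) v \<longrightarrow>
        arc_ok F x (times (walk_length F x) S (lft a)) (lft a) (rgt a)) \<and>
     (\<forall>q\<in>set (list_of S). q \<noteq> Lf \<and> rgt (rgt q) = v \<longrightarrow>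
        (\<exists>q'\<in>set (list_of S). q' \<noteq> Lf \<and> lft (rgt q') = v \<and>
           lft q' = (if Nd Lf (lft q) = nv (walk_length F x) then Lf else Nd Lf (lft q)))) \<and>
     (\<forall>q\<in>set (list_of S). q \<noteq> Lf \<and> lft (rgt q) = v \<and> lft q = Lf \<longrightarrow> v = in_root x)"

text \<open>\<open>A\<close> and \<open>B\<close> are pairs of a vertex and its timetable. The first
  conjunct makes pairwise compatible pairs a partial assignment; for distinct vertices the second
  one concerns the arcs joining them.\<close>

definition pair_ok :: "nat \<Rightarrow> val \<Rightarrow> val \<Rightarrow> val \<Rightarrow> bool" where
  "pair_ok F x A B \<longleftrightarrow> (lft A = lft B \<longrightarrow> A = B) \<and>
     (\<forall>a\<in>set (in_f x). incident (lft a) (lft A) \<and> incident (lft a) (lft B) \<longrightarrow>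
        times (walk_length F x) (rgt A) (lft a) = times (walk_length F x) (rgt B) (lft a))"

definition slots :: "nat \<Rightarrow> val \<Rightarrow> val list" where
  "slots F x = Lf # concat (map (\<lambda>t. map (\<lambda>a. Nd t (lft a)) (in_f x)) (map nv [0..<walk_length F x]))"

definition atoms :: "nat \<Rightarrow> nat \<Rightarrow> val \<Rightarrow> val list" where
  "atoms F m x = concat (map (\<lambda>v. filter (\<lambda>A. vertex_ok F x (lft A) (rgt A))
     (map (\<lambda>S. Nd v S) (map list_val (List.n_lists m (slots F x))))) (in_verts x))"

definition init_tuples :: "nat \<Rightarrow> nat \<Rightarrow> nat \<Rightarrow> val \<Rightarrow> val list" where
  "init_tuples F m k x = filter (\<lambda>h. \<forall>A\<in>set (list_of h). \<forall>B\<in>set (list_of h). pair_ok F x A B)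
     (map list_val (List.n_lists k (atoms F m x)))"

text \<open>In \<open>h'\<close> the head is the pebble just moved and the tail \<open>r\<close>
  holds those that were kept. Since \<open>r\<close> may repeat members, keeping fewer than
  \<open>k - 1\<close> pebbles is covered as well.\<close>

definition refine :: "nat \<Rightarrow> val list \<Rightarrow> val list \<Rightarrow> val list" where
  "refine k vs H = filter (\<lambda>h. \<forall>r\<in>set (map list_val (List.n_lists (k - 1) (list_of h))).
     \<forall>v\<in>set vs. \<exists>h'\<in>set H. rgt h' = r \<and> lft (lft h') = v) H"

text \<open>The list folded over serves only as a counter of rounds.\<close>

definition decide :: "nat \<Rightarrow> nat \<Rightarrow> nat \<Rightarrow> val \<Rightarrow> bool" where
  "decide F m k x \<longleftrightarrow>
     foldr (\<lambda>_. refine k (in_verts x)) (init_tuples F m k x) (init_tuples F m k x) \<noteq> []"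

section \<open>Polynomial running time of the procedure\<close>

lemma ptimel_times:
  assumes "ptimen L" "ptime S" "ptime e"
  shows "ptimel (\<lambda>z. map nv (times (L z) (S z) (e z)))"
proof -
  have "ptimel (\<lambda>z. filter (\<lambda>t. Nd t (e z) \<in> set (list_of (S z))) (map nv [0..<L z]))"
    \<comment> \<open>Below the filter the parameters are evaluated at a projection of the paired
      argument; \<open>assms[THEN ptime_comp]\<close> provides these forms.\<close>
    by (intro ptime_intros assms assms[THEN ptime_comp])
  then show ?thesis by (simp add: times_def filter_map comp_def)
qed

lemma ptimen_gap:
  assumes "ptimen L" "ptimel (\<lambda>z. map nv (p z))"
  shows "ptimen (\<lambda>z. gap (L z) (p z) y)"
  unfolding gap_def by (intro ptime_intros assms)

lemma ptimeb_arc_ok: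
  assumes "ptime x" "ptimel (\<lambda>z. map nv (p z))" "ptime e" "ptime fe"
  shows "ptimeb (\<lambda>z. arc_ok F (x z) (p z) (e z) (fe z))"
  unfolding arc_ok_def
  by (intro ptime_intros ptimel_in ptimen_gap ptimen_walk_length assms assms[THEN ptime_comp])

lemma ptimeb_incident: "ptime e \<Longrightarrow> ptime v \<Longrightarrow> ptimeb (\<lambda>z. incident (e z) (v z))"
  unfolding incident_def by (intro ptime_intros)

lemma ptimeb_vertex_ok:
  assumes "ptime x" "ptime v" "ptime S"
  shows "ptimeb (\<lambda>z. vertex_ok F (x z) (v z) (S z))"
  unfolding vertex_ok_def
  by (intro ptime_intros ptimel_in ptimeb_arc_ok ptimel_times ptimeb_incident ptimen_walk_length
      assms assms[THEN ptime_comp])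

lemma ptimeb_pair_ok:
  assumes "ptime x" "ptime A" "ptime B"
  shows "ptimeb (\<lambda>z. pair_ok F (x z) (A z) (B z))"
  unfolding pair_ok_def
  by (intro ptime_intros ptimel_in ptimel_times ptimeb_incident ptimen_walk_length
      assms assms[THEN ptime_comp])

lemma ptimel_slots:
  assumes "ptime x"
  shows "ptimel (\<lambda>z. slots F (x z))"
  unfolding slots_def
  by (intro ptimel_Cons ptime_intros ptimel_in ptimen_walk_length assms assms[THEN ptime_comp])

lemma ptimel_atoms:
  assumes "ptime x"
  shows "ptimel (\<lambda>z. atoms F m (x z))"
  unfolding atoms_def
  by (intro ptime_intros ptimel_in ptimel_slots ptimeb_vertex_ok assms assms[THEN ptime_comp])

lemma ptimel_init_tuples:
  assumes "ptime x"
  shows "ptimel (\<lambda>z. init_tuples F m k (x z))"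
  unfolding init_tuples_def
  by (intro ptime_intros ptimel_atoms ptimeb_pair_ok assms assms[THEN ptime_comp])

lemma ptimel_refine:
  assumes "ptimel vs" "ptimel H"
  shows "ptimel (\<lambda>z. refine k (vs z) (H z))"
  unfolding refine_def
  by (intro ptime_intros assms assms[THEN ptime_comp])

text \<open>A round only filters, so the value of the loop never outgrows the initial list; this is
  the bound that the fold requires.\<close>

lemma ptimeb_decide: "ptimeb (decide F m k)"
proof -
  let ?H = "\<lambda>x. init_tuples F m k x"
  let ?s = "\<lambda>x _ r. list_val (refine k (in_verts x) (list_of r))"
  have *: "foldr (?s x) xs (list_val H) = list_val (foldr (\<lambda>_. refine k (in_verts x)) xs H)"
    for x and xs :: "val list" and H
    by (induction xs) auto
  have "ptimel ?H" by (intro ptimel_init_tuples ptime_id)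
  then obtain q where q: "size (list_val (?H x)) \<le> poly q (size x)" for x
    unfolding ptime_def runs_def by blast
  have "ptime (\<lambda>x. foldr (?s x) (?H x) (list_val (?H x)))"
  proof (rule ptime_foldr[where q = q])
    fix x and xs :: "val list"
    have sz: "size (list_val (filter P ys)) \<le> size (list_val ys)" for P and ys :: "val list"
      by (induction ys) auto
    have "size (foldr (?s x) xs (list_val (?H x))) \<le> size (list_val (?H x))"
    proof (induction xs)
      case (Cons a xs)
      show ?case using sz Cons unfolding refine_def
        by (simp add: refine_def) (metis (no_types, lifting) list_val_list_of order_trans)
    qed simp
    also note q[of x]
    also have "poly q (size x) \<le> poly q (size x + size (list_val xs))"
      by (intro poly_nat_mono) simp
    finally show "size (foldr (?s x) xs (list_val (?H x))) \<le> poly q (size x + size (list_val xs))" .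
  qed (intro ptimel_init_tuples ptimel_refine ptimel_in ptime_intros)+
  then have "ptimel (\<lambda>x. foldr (\<lambda>_. refine k (in_verts x)) (?H x) (?H x))"
    by (simp add: *)
  from ptimeb_not[OF ptime_eq[OF this ptime_const[of Lf]]] show ?thesis
    by (simp add: decide_def[abs_def])
qed

lemma poly_time_decidableI:
  assumes "ptimeb D" "\<And>I x. promise I \<Longrightarrow> enc I x \<Longrightarrow> D x \<longleftrightarrow> question I"
  shows "poly_time_decidable promise enc question"
proof -
  from assms(1) obtain P q where P: "runs P 0 (\<lambda>z. bool_val (D z)) q" unfolding ptime_def by blast
  show ?thesis unfolding poly_time_decidable_def
  \<comment> \<open>The summand 2 pays for evaluating the argument and for the call of function
    0.\<close>
  proof (intro exI[of _ P] exI[of _ "q + 2"] allI impI)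
    fix I x
    assume I: "promise I" "enc I x"
    have "eval P [x] (Var 0) x 1" using eval_Var[of 0 "[x]"] by simp
    from runs_call[OF P this] obtain t where "eval P [x] (Call 0 [Var 0]) (bool_val (D x)) t"
      "t \<le> 1 + poly q (size x) + 1" .
    then show "\<exists>t\<le>poly (q + 2) (size x). computes_in P x (if question I then Nd Lf Lf else Lf) t"
      using assms(2)[OF I] by (intro exI[of _ t]) (auto simp: computes_in_def bool_val_def)
  qed
qed

section \<open>Gluing local solutions along a tree decomposition\<close>

abbreviation adj :: "'a set set \<Rightarrow> 'a set \<Rightarrow> ('a \<times> 'a) set" where
  "adj E X \<equiv> {(x, y). x \<in> X \<and> y \<in> X \<and> {x, y} \<in> E}"

lemma awalk_sym_orientation:
  "pre_digraph.awalk (sym_orientation V E) u p v \<longleftrightarrow> u \<in> V \<and> set p \<subseteq> sym_arcs E \<and> pcas u p v"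
  by (simp add: pre_digraph.awalk_def sym_orientation_def cas_with_proj_eq)

lemma connected_adj:
  assumes "connected (sym_orientation V E)" "u \<in> V" "v \<in> V"
  shows "(u, v) \<in> (adj E V)\<^sup>*"
proof -
  have "(u, v) \<in> rtrancl_on V ((sym_arcs E)\<^sup>s)"
    using assms by (simp add: connected_conv sym_orientation_def)
  then show ?thesis
  proof induction
    case (step y z)
    then have "{y, z} \<in> E \<or> {z, y} \<in> E" by (auto simp: symcl_def sym_arcs_def)
    then have "{y, z} \<in> E" by (metis insert_commute)
    with step have "(y, z) \<in> adj E V" by simp
    then show ?case using step(5) by (rule converse_rtrancl_into_rtrancl)
  qed simp
qed

text \<open>\<open>pcas\<close> refers to arcs only and not to a digraph, so a simple path found in
  the subgraph induced on \<open>X\<close> can be reused in the whole graph.\<close>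

lemma adj_pcas:
  assumes "(a, c) \<in> (adj E X)\<^sup>*" "a \<in> X"
  obtains p where "set p \<subseteq> sym_arcs E" "pcas a p c" "distinct (pawalk_verts a p)"
    "set (pawalk_verts a p) \<subseteq> X"
proof -
  define G where "G = sym_orientation X {e \<in> E. e \<subseteq> X}"
  interpret wf_digraph G
    by unfold_locales (auto simp: G_def sym_orientation_def sym_arcs_def)
  have "(a, c) \<in> rtrancl_on X (sym_arcs {e \<in> E. e \<subseteq> X})"
    using assms(1)
  proof induction
    case (step y z)
    then show ?case by (auto intro: rtrancl_on_into_rtrancl_on[of _ y] simp: sym_arcs_def)
  qed (use assms in auto)
  then have "a \<rightarrow>\<^sup>*\<^bsub>G\<^esub> c" by (simp add: reachable_def G_def sym_orientation_def)
  then obtain p where p: "apath a p c" using reachable_apath by blast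
  then have *: "awalk a p c" "distinct (awalk_verts a p)" by (auto simp: apath_def)
  have "set (awalk_verts a p) \<subseteq> verts G" by (rule awalkE[OF *(1)])
  with * show thesis
    unfolding G_def awalk_sym_orientation
    by (intro that[of p])
      (auto simp: sym_orientation_def awalk_verts_with_proj_eq sym_arcs_def)
qed

lemma pcas_append: "pcas u (p @ q) v \<longleftrightarrow> (\<exists>w. pcas u p w \<and> pcas w q v)"
  by (induction p arbitrary: u) auto

lemma pawalk_verts_snoc: "pcas u p v \<Longrightarrow> pawalk_verts u (p @ [(v, w)]) = pawalk_verts u p @ [w]"
  by (induction p arbitrary: u) auto

text \<open>Otherwise a simple path from \<open>a\<close> to \<open>c\<close> avoiding
  \<open>u\<close>, closed up through \<open>u\<close>, would be a cycle of length at least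
  3.\<close>

lemma undirected_tree_no_detour:
  assumes tree: "undirected_tree N T"
    and ac: "{u, a} \<in> T" "{c, u} \<in> T" "a \<noteq> u" and p: "(a, c) \<in> (adj T (N - {u}))\<^sup>*"
  shows "a = c"
proof (rule ccontr)
  assume "a \<noteq> c"
  have N: "u \<in> N" "a \<in> N" using ac(1) tree by (auto simp: undirected_tree_def simple_graph_def)
  from adj_pcas[OF p] N ac(3) obtain p where p: "set p \<subseteq> sym_arcs T" "pcas a p c"
    "distinct (pawalk_verts a p)" "set (pawalk_verts a p) \<subseteq> N - {u}" by blast
  let ?p = "(u, a) # p @ [(c, u)]"
  have "pre_digraph.cycle (sym_orientation N T) ?p"
    unfolding pre_digraph.cycle_def
  proof (intro exI conjI)
    show "pre_digraph.awalk (sym_orientation N T) u ?p u"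
      using N ac p by (auto simp: awalk_sym_orientation pcas_append sym_arcs_def)
    show "distinct (tl (pre_digraph.awalk_verts (sym_orientation N T) u ?p))"
      using p by (auto simp: sym_orientation_def awalk_verts_with_proj_eq pawalk_verts_snoc)
  qed simp
  moreover have "p \<noteq> []" using p(2) \<open>a \<noteq> c\<close> by auto
  then have "length ?p \<ge> 3" by (cases p) auto
  ultimately show False using tree unfolding undirected_tree_def by blast
qed

text \<open>Cut the path at its last visit to \<open>u\<close>.\<close>

lemma rtrancl_leave:
  assumes "(u, x) \<in> R\<^sup>*" "u \<noteq> x"
  obtains q where "(u, q) \<in> R" "q \<noteq> u" "(q, x) \<in> {(a, b) \<in> R. a \<noteq> u \<and> b \<noteq> u}\<^sup>*"
proof -
  from assms have "\<exists>q. (u, q) \<in> R \<and> q \<noteq> u \<and> (q, x) \<in> {(a, b) \<in> R. a \<noteq> u \<and> b \<noteq> u}\<^sup>*"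
  proof (induction rule: rtrancl_induct)
    case (step y z)
    show ?case
    proof (cases "u = y")
      case False
      with step obtain q where "(u, q) \<in> R" "q \<noteq> u" "(q, y) \<in> {(a, b) \<in> R. a \<noteq> u \<and> b \<noteq> u}\<^sup>*"
        by blast
      moreover have "(y, z) \<in> {(a, b) \<in> R. a \<noteq> u \<and> b \<noteq> u}" using step False by auto
      ultimately show ?thesis by (meson rtrancl_into_rtrancl)
    qed (use step in auto)
  qed simp
  with that show thesis by blast
qed

text \<open>The nodes whose bags contain \<open>v\<close> connect \<open>u\<close> with
  \<open>x\<close>. Let \<open>q\<close> be the node after the last visit to \<open>u\<close> on
  such a path. It is joined to \<open>p\<close> avoiding \<open>u\<close>, via \<open>x\<close> and
  through \<open>S\<close>, so \<open>q = p\<close> in a tree, and the bag of \<open>q\<close>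
  contains \<open>v\<close>.\<close>

lemma tree_decomposition_separator:
  assumes td: "tree_decomposition V E N T b"
    and S: "S \<subseteq> N" "\<And>x y. x \<in> S \<Longrightarrow> y \<in> S \<Longrightarrow> (x, y) \<in> (adj T S)\<^sup>*"
    and u: "u \<in> N" "u \<notin> S" "p \<in> S" "{p, u} \<in> T" and x: "x \<in> S"
  shows "b u \<inter> b x \<subseteq> b p"
proof
  fix v
  assume v: "v \<in> b u \<inter> b x"
  let ?B = "{x \<in> N. v \<in> b x}"
  have "v \<in> V" using v u(1) td by (auto simp: tree_decomposition_def)
  then have "connected (sym_orientation ?B {e \<in> T. \<forall>x\<in>e. v \<in> b x})"
    using td by (auto simp: tree_decomposition_def)
  from connected_adj[OF this, of u x] have "(u, x) \<in> (adj {e \<in> T. \<forall>x\<in>e. v \<in> b x} ?B)\<^sup>*"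
    using v u x S by auto
  moreover have "u \<noteq> x" using u x by auto
  ultimately obtain q where q: "(u, q) \<in> adj {e \<in> T. \<forall>x\<in>e. v \<in> b x} ?B" "q \<noteq> u"
    "(q, x) \<in> {(a, c) \<in> adj {e \<in> T. \<forall>x\<in>e. v \<in> b x} ?B. a \<noteq> u \<and> c \<noteq> u}\<^sup>*"
    by (rule rtrancl_leave)
  have "(q, x) \<in> (adj T (N - {u}))\<^sup>*"
    using q(3) by (rule set_rev_mp[OF _ rtrancl_mono]) auto
  also have "(x, p) \<in> (adj T (N - {u}))\<^sup>*"
    using S(2)[OF x u(3)] by (rule set_rev_mp[OF _ rtrancl_mono]) (use S u in auto)
  finally have "(q, p) \<in> (adj T (N - {u}))\<^sup>*" .
  then have "q = p"
    using td q u by (intro undirected_tree_no_detour[of N T u]) (auto simp: tree_decomposition_def)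
  with q(1) show "v \<in> b p" by auto
qed

text \<open>
  \<open>M\<close> is a winning strategy in the existential \<open>k\<close>-pebble game: a family of local solutions in which
  any part of a member can be kept while the remaining pebbles are moved to arbitrary variables.
\<close>

lemma tree_decomposition_glue:
  assumes td: "tree_decomposition V E N T b" and fin: "finite V"
    and card: "\<And>x. x \<in> N \<Longrightarrow> card (b x) \<le> k"
    and ne: "M \<noteq> {}"
    and ext: "\<And>A K W. A \<in> M \<Longrightarrow> K \<subseteq> A \<Longrightarrow> finite K \<Longrightarrow> W \<subseteq> V \<Longrightarrow> card K + card W \<le> k \<Longrightarrow>
      \<exists>A'\<in>M. K \<subseteq> A' \<and> W \<subseteq> fst ` A'"
  shows "\<exists>s. \<forall>x\<in>N. \<exists>A\<in>M. \<forall>v\<in>b x. (v, s v) \<in> A"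
proof -
  \<comment> \<open>A connected part of the tree that is already solved. It grows by one adjacent
    node at a time, as the separator lemma demands.\<close>
  define P where "P S \<longleftrightarrow> S \<subseteq> N \<and> (\<forall>x\<in>S. \<forall>y\<in>S. (x, y) \<in> (adj T S)\<^sup>*) \<and>
    (\<exists>s. \<forall>x\<in>S. \<exists>A\<in>M. \<forall>v\<in>b x. (v, s v) \<in> A)" for S
  have tree: "undirected_tree N T" and bV: "\<And>x. x \<in> N \<Longrightarrow> b x \<subseteq> V"
    using td by (auto simp: tree_decomposition_def)
  then have finN: "finite N" and conN: "connected (sym_orientation N T)"
    by (auto simp: undirected_tree_def simple_graph_def)
  have finb: "finite (b x)" if "x \<in> N" for x using bV[OF that] fin finite_subset by blast
  have pick: "(v, SOME d. (v, d) \<in> A) \<in> A" if "v \<in> fst ` A" for v A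
    using that by (auto intro: someI)
  have "\<exists>S. P S \<and> card S = Suc n" if "Suc n \<le> card N" for n
    using that
  proof (induction n)
    case 0
    then obtain r where r: "r \<in> N" by fastforce
    from ne obtain A where "A \<in> M" by blast
    with ext[of A "{}" "b r"] bV[OF r] card[OF r] obtain A' where A': "A' \<in> M" "b r \<subseteq> fst ` A'"
      by auto
    have "P {r}" unfolding P_def
      using A' r pick[of _ A'] by (auto intro!: exI[of _ "\<lambda>v. SOME d. (v, d) \<in> A'"] bexI[of _ A'])
    then show ?case by (intro exI[of _ "{r}"]) simp
  next
    case (Suc n)
    then obtain S where S: "P S" "card S = Suc n" by auto
    then obtain s where s: "\<forall>x\<in>S. \<exists>A\<in>M. \<forall>v\<in>b x. (v, s v) \<in> A" unfolding P_def by blast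
    have SN: "S \<subseteq> N" and con: "\<And>x y. x \<in> S \<Longrightarrow> y \<in> S \<Longrightarrow> (x, y) \<in> (adj T S)\<^sup>*"
      using S(1) by (auto simp: P_def)
    have "S \<noteq> N" using S(2) Suc.prems by auto
    with SN obtain z where z: "z \<in> N" "z \<notin> S" by blast
    from S(2) obtain x where x: "x \<in> S" by fastforce
    have "(x, z) \<in> (adj T N)\<^sup>*" using connected_adj[OF conN] x z SN by auto
    then have "\<exists>p u. p \<in> S \<and> u \<in> N \<and> u \<notin> S \<and> {p, u} \<in> T"
      using z(2)
    proof (induction rule: rtrancl_induct)
      case (step y z)
      then show ?case by (cases "y \<in> S") auto
    qed (use x in auto)
    then obtain p u where pu: "p \<in> S" "u \<in> N" "u \<notin> S" "{p, u} \<in> T" by blast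
    have sep: "b u \<inter> b x \<subseteq> b p" if "x \<in> S" for x
      using tree_decomposition_separator[OF td SN con pu(2,3,1,4) that] .
    from s pu(1) obtain A where A: "A \<in> M" "\<forall>v\<in>b p. (v, s v) \<in> A" by blast
    \<comment> \<open>Pebbles on the separator are kept and the others go to the new vertices of the
      bag; together they number at most \<open>card (b u)\<close>.\<close>
    let ?K = "(\<lambda>v. (v, s v)) ` (b u \<inter> b p)" and ?W = "b u - b p"
    have "card ?K + card ?W \<le> card (b u \<inter> b p) + card ?W"
      using finb[OF pu(2)] by (intro add_mono card_image_le) auto
    also have "\<dots> = card (b u)"
      using finb[OF pu(2)] by (subst card_Un_disjoint[symmetric]) (auto intro: arg_cong[of _ _ card])
    also have "\<dots> \<le> k" by (rule card[OF pu(2)])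
    finally have "card ?K + card ?W \<le> k" .
    with ext[of A ?K ?W] A finb[OF pu(2)] bV[OF pu(2)]
    obtain A' where A': "A' \<in> M" "?K \<subseteq> A'" "?W \<subseteq> fst ` A'" by blast
    define s' where "s' v = (if v \<in> ?W then SOME d. (v, d) \<in> A' else s v)" for v
    have "\<exists>A\<in>M. \<forall>v\<in>b x. (v, s' v) \<in> A" if "x \<in> insert u S" for x
    proof (cases "x = u")
      case True
      have "(v, s' v) \<in> A'" if "v \<in> b u" for v
        using that A'(2,3) pick[of v A'] by (cases "v \<in> b p") (auto simp: s'_def)
      with A'(1) True show ?thesis by blast
    next
      case False
      with that have x: "x \<in> S" by simp
      with s obtain B where "B \<in> M" "\<forall>v\<in>b x. (v, s v) \<in> B" by blast
      \<comment> \<open>A vertex of \<open>b u\<close> outside \<open>b p\<close> occurs in no bag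
        of \<open>S\<close>, so the new values do not disturb the old bags.\<close>
      moreover have "s' v = s v" if "v \<in> b x" for v using sep[OF x] that by (auto simp: s'_def)
      ultimately show ?thesis by auto
    qed
    moreover have "(x, y) \<in> (adj T (insert u S))\<^sup>*" if "x \<in> insert u S" "y \<in> insert u S" for x y
    proof -
      have S': "(x, y) \<in> (adj T (insert u S))\<^sup>*" if "x \<in> S" "y \<in> S" for x y
        using con[OF that] by (rule set_rev_mp[OF _ rtrancl_mono]) auto
      have pu': "(p, u) \<in> adj T (insert u S)" "(u, p) \<in> adj T (insert u S)"
        using pu by (auto simp: insert_commute)
      show ?thesis
      proof (cases "x = u"; cases "y = u")
        assume "x = u" "y \<noteq> u"
        with that S'[of p y] pu pu'(2) show ?thesis by (auto intro: converse_rtrancl_into_rtrancl)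
      next
        assume "x \<noteq> u" "y = u"
        with that S'[of x p] pu pu'(1) show ?thesis by (auto intro: rtrancl_into_rtrancl)
      qed (use that S' in auto)
    qed
    ultimately have "P (insert u S)" unfolding P_def using SN pu by blast
    moreover have "card (insert u S) = Suc (Suc n)"
      using S(2) pu(3) SN finN finite_subset by (subst card_insert_disjoint) auto
    ultimately show ?case by blast
  qed
  from this[of "card N - 1"] show ?thesis
  proof (cases "N = {}")
    case False
    then have "card N > 0" using finN by (simp add: card_gt_0_iff)
    with \<open>Suc (card N - 1) \<le> card N \<Longrightarrow> \<exists>S. P S \<and> card S = Suc (card N - 1)\<close>
    obtain S where "P S" "card S = card N" by auto
    moreover from this have "S = N" using finN card_subset_eq[of N S] by (simp add: P_def)
    ultimately show ?thesis by (auto simp: P_def)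
  qed simp
qed

section \<open>Correctness of the consistency procedure\<close>

lemma refine_eq_filter:
  "refine k vs H = filter (\<lambda>h. \<forall>r. length r = k - 1 \<and> set r \<subseteq> set (list_of h) \<longrightarrow>
     (\<forall>v\<in>set vs. \<exists>h'\<in>set H. rgt h' = list_val r \<and> lft (lft h') = v)) H"
  unfolding refine_def by (rule filter_cong) (auto simp: set_n_lists)

text \<open>Each round before stabilisation discards an element. After \<open>length H\<close>
  rounds the list is therefore stable or empty, and the empty list is stable too.\<close>

lemma foldr_filter_fixpoint:
  assumes s: "\<And>H. s H = filter (Q H) H"
  shows "s (foldr (\<lambda>_. s) H H) = foldr (\<lambda>_. s) H H"
proof -
  have "s (foldr (\<lambda>_. s) xs H) = foldr (\<lambda>_. s) xs H \<or>
      length (foldr (\<lambda>_. s) xs H) + length xs \<le> length H" for xs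
  proof (induction xs)
    case (Cons a xs)
    let ?F = "foldr (\<lambda>_. s) xs H"
    show ?case
    proof (cases "s ?F = ?F")
      case False
      then have "length (s ?F) < length ?F"
        unfolding s[of ?F] by (auto simp: filter_id_conv intro: length_filter_less)
      with False Cons show ?thesis by auto
    qed simp
  qed simp
  from this[of H] show ?thesis by (auto simp: s[of "[]"])
qed

lemma foldr_filter_subset:
  assumes s: "\<And>H. s H = filter (Q H) H"
  shows "set (foldr (\<lambda>_. s) xs H) \<subseteq> set H"
  by (induction xs) (auto simp: s)

lemma decideE:
  assumes "decide F m k x"
  obtains H where "H \<noteq> {}" "H \<subseteq> set (init_tuples F m k x)"
    "\<And>h r v. h \<in> H \<Longrightarrow> length r = k - 1 \<Longrightarrow> set r \<subseteq> set (list_of h) \<Longrightarrow> v \<in> set (in_verts x) \<Longrightarrow>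
      \<exists>h'\<in>H. rgt h' = list_val r \<and> lft (lft h') = v"
proof
  let ?s = "refine k (in_verts x)"
  let ?H = "foldr (\<lambda>_. ?s) (init_tuples F m k x) (init_tuples F m k x)"
  show "set ?H \<noteq> {}" using assms by (simp add: decide_def)
  show "set ?H \<subseteq> set (init_tuples F m k x)"
    by (rule foldr_filter_subset) (rule refine_eq_filter)
  fix h r v
  assume "h \<in> set ?H" "length r = k - 1" "set r \<subseteq> set (list_of h)" "v \<in> set (in_verts x)"
  moreover have "?s ?H = ?H" by (rule foldr_filter_fixpoint) (rule refine_eq_filter)
  ultimately show "\<exists>h'\<in>set ?H. rgt h' = list_val r \<and> lft (lft h') = v"
    unfolding refine_eq_filter[of k "in_verts x" ?H] filter_id_conv by blast
qed

text \<open>A family closed under moves survives every round, because the test in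
  \<open>refine\<close> is monotone in the list of available tuples.\<close>

lemma decideI:
  assumes "G \<noteq> {}" "G \<subseteq> set (init_tuples F m k x)"
    "\<And>h r v. h \<in> G \<Longrightarrow> length r = k - 1 \<Longrightarrow> set r \<subseteq> set (list_of h) \<Longrightarrow> v \<in> set (in_verts x) \<Longrightarrow>
      \<exists>h'\<in>G. rgt h' = list_val r \<and> lft (lft h') = v"
  shows "decide F m k x"
proof -
  have "G \<subseteq> set (foldr (\<lambda>_. refine k (in_verts x)) xs (init_tuples F m k x))" for xs :: "val list"
  proof (induction xs)
    case (Cons a xs)
    then show ?case using assms(3) by (simp add: refine_eq_filter) blast
  qed (use assms(2) in simp)
  with assms(1) show ?thesis unfolding decide_def by (metis empty_set subset_empty)
qed

lemma exists_list_between: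
  assumes "X \<subseteq> set l" "card X \<le> n" "l \<noteq> []"
  shows "\<exists>r. length r = n \<and> X \<subseteq> set r \<and> set r \<subseteq> set l"
proof -
  have "finite X" using assms(1) finite_subset by blast
  then obtain xs where xs: "set xs = X" "distinct xs" using finite_distinct_list by blast
  then have "length xs \<le> n" using assms(2) distinct_card by force
  with xs assms show ?thesis
    \<comment> \<open>Missing places are filled with copies of one member of \<open>l\<close>, as
      pebbles may coincide.\<close>
    by (intro exI[of _ "xs @ replicate (n - length xs) (hd l)"]) auto
qed

text \<open>The procedure moves one pebble at a time. Several vertices are reached in succession,
  keeping \<open>X\<close> and one member for each vertex already reached, so at most
  \<open>k - 1\<close> members before each move.\<close>

lemma decide_extend:
  assumes k: "k > 0"
    and H: "H \<subseteq> set (init_tuples F m k x)"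
      "\<And>h r v. h \<in> H \<Longrightarrow> length r = k - 1 \<Longrightarrow> set r \<subseteq> set (list_of h) \<Longrightarrow> v \<in> set (in_verts x) \<Longrightarrow>
        \<exists>h'\<in>H. rgt h' = list_val r \<and> lft (lft h') = v"
    and h: "h \<in> H" and X: "X \<subseteq> set (list_of h)"
    and W: "finite W" "W \<subseteq> set (in_verts x)" "card X + card W \<le> k"
  shows "\<exists>h'\<in>H. X \<subseteq> set (list_of h') \<and> W \<subseteq> lft ` set (list_of h')"
  using W
proof (induction W rule: finite_induct)
  case empty
  with h X show ?case by auto
next
  case (insert w W)
  then obtain h' where h': "h' \<in> H" "X \<subseteq> set (list_of h')" "W \<subseteq> lft ` set (list_of h')" by auto
  have len: "length (list_of h) = k" if "h \<in> H" for h
    using H(1) that by (auto simp: init_tuples_def set_n_lists)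
  \<comment> \<open>Choosing one member for each vertex of \<open>W\<close> limits the number of
    additional members to keep to \<open>card W\<close>.\<close>
  from h'(3) obtain Y where Y: "Y \<subseteq> set (list_of h')" "W = lft ` Y" "inj_on lft Y"
    by (rule subset_image_inj[THEN iffD1, THEN exE]) blast
  then have "card Y = card W" by (simp add: card_image)
  then have "card (X \<union> Y) \<le> k - 1"
    using insert.hyps insert.prems card_Un_le[of X Y] by simp
  moreover have "list_of h' \<noteq> []" using len[OF h'(1)] k by auto
  ultimately obtain r where r: "length r = k - 1" "X \<union> Y \<subseteq> set r" "set r \<subseteq> set (list_of h')"
    using exists_list_between[of "X \<union> Y" "list_of h'" "k - 1"] h'(2) Y(1) by blast
  from H(2)[OF h'(1) r(1,3), of w] insert.prems
  obtain h'' where h'': "h'' \<in> H" "rgt h'' = list_val r" "lft (lft h'') = w" by auto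
  from len[OF h''(1)] k obtain a where "h'' = Nd a (list_val r)"
    using h''(2) by (cases h'') auto
  with h'' r(2) Y(2) show ?case by (intro bexI[of _ h'']) auto
qed

lemma mem_init_tuples:
  assumes "h \<in> set (init_tuples F m k x)"
  shows "length (list_of h) = k" "set (list_of h) \<subseteq> set (atoms F m x)"
    "A \<in> set (list_of h) \<Longrightarrow> B \<in> set (list_of h) \<Longrightarrow> pair_ok F x A B"
  using assms by (auto simp: init_tuples_def set_n_lists)

lemma mem_atoms:
  "Nd v S \<in> set (atoms F m x) \<longleftrightarrow> v \<in> set (in_verts x) \<and> length (list_of S) = m \<and>
     set (list_of S) \<subseteq> set (slots F x) \<and> vertex_ok F x v S"
  by (auto simp: atoms_def set_n_lists image_iff) (metis list_val_list_of)

lemma atoms_Nd: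
  assumes "A \<in> set (atoms F m x)"
  obtains v S where "A = Nd v S"
  using assms by (auto simp: atoms_def)

text \<open>The \<open>k\<close>-tuples cut out of a global solution are closed under moves: the
  moved pebble takes the value that the solution prescribes.\<close>

lemma decide_if_solution:
  assumes k: "k > 0" and ne: "in_verts x \<noteq> []"
    and s: "\<And>v. v \<in> set (in_verts x) \<Longrightarrow> Nd v (s v) \<in> set (atoms F m x)"
    and ok: "\<And>u v. u \<in> set (in_verts x) \<Longrightarrow> v \<in> set (in_verts x) \<Longrightarrow>
      pair_ok F x (Nd u (s u)) (Nd v (s v))"
  shows "decide F m k x"
proof (rule decideI)
  let ?A = "(\<lambda>v. Nd v (s v)) ` set (in_verts x)"
  let ?G = "list_val ` {h. length h = k \<and> set h \<subseteq> ?A}"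
  from ne have "replicate k (Nd (hd (in_verts x)) (s (hd (in_verts x)))) \<in> {h. length h = k \<and> set h \<subseteq> ?A}"
    by auto
  then show "?G \<noteq> {}" by blast
  show "?G \<subseteq> set (init_tuples F m k x)"
    unfolding init_tuples_def set_filter set_map set_n_lists
  proof safe
    fix h
    assume h: "set h \<subseteq> ?A" "k = length h"
    then show "list_val h \<in> list_val ` {ys. length ys = length h \<and> set ys \<subseteq> set (atoms F m x)}"
      using s by blast
    fix A B
    assume "A \<in> set (list_of (list_val h))" "B \<in> set (list_of (list_val h))"
    with h have "A \<in> ?A" "B \<in> ?A" by auto
    then show "pair_ok F x A B" using ok by blast
  qed
  fix h r v
  assume *: "h \<in> ?G" "length r = k - 1" "set r \<subseteq> set (list_of h)" "v \<in> set (in_verts x)"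
  then have "set (list_of h) \<subseteq> ?A" by auto
  with *(3) have "set r \<subseteq> ?A" by (rule order_trans)
  with k * have "Nd v (s v) # r \<in> {h. length h = k \<and> set h \<subseteq> ?A}" by simp
  then have "list_val (Nd v (s v) # r) \<in> ?G" by (rule imageI)
  then show "\<exists>h'\<in>?G. rgt h' = list_val r \<and> lft (lft h') = v" by (rule bexI[rotated]) simp
qed

section \<open>Walks as timetables\<close>

lemma list_all2_eq_map: "list_all2 (\<lambda>a x. x = r a) as ys \<longleftrightarrow> ys = map r as"
  by (induction as arbitrary: ys) (auto simp: list_all2_Cons1)

text \<open>When elements have unique codes, as numbers and pairs of numbers do, only the order of
  listing is left open.\<close>

lemma enc_set_eq:
  "enc_set (\<lambda>a x. x = r a) A x \<longleftrightarrow> (\<exists>as. distinct as \<and> set as = A \<and> x = list_val (map r as))"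
  by (auto simp: enc_set_def list_all2_eq_map)

lemma enc_pair_eq:
  "enc_pair (\<lambda>a x. x = r a) (\<lambda>b x. x = s b) = (\<lambda>p x. x = Nd (r (fst p)) (s (snd p)))"
  by (auto simp: enc_pair_def fun_eq_iff)

lemma enc_nat_eq: "enc_nat = (\<lambda>n x. x = nat_val n)"
  by (auto simp: enc_nat_def fun_eq_iff)

lemma enc_fun_eq:
  "enc_fun (\<lambda>a x. x = r a) (\<lambda>b x. x = s b) A f x \<longleftrightarrow>
    (\<exists>as. distinct as \<and> set as = A \<and> x = list_val (map (\<lambda>a. Nd (r a) (s (f a))) as))"
proof
  assume "enc_fun (\<lambda>a x. x = r a) (\<lambda>b x. x = s b) A f x"
  then obtain ps where ps: "distinct ps" "set ps = (\<lambda>a. (a, f a)) ` A"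
    "x = list_val (map (\<lambda>p. Nd (r (fst p)) (s (snd p))) ps)"
    by (auto simp: enc_fun_def enc_pair_eq enc_set_eq)
  have "ps = map (\<lambda>a. (a, f a)) (map fst ps)"
    using ps(2) by (auto simp: comp_def intro!: map_idI[symmetric])
  moreover from this ps(1) have "distinct (map fst ps)" by (metis distinct_map)
  moreover have "set (map fst ps) = A" using ps(2) by force
  ultimately show "\<exists>as. distinct as \<and> set as = A \<and> x = list_val (map (\<lambda>a. Nd (r a) (s (f a))) as)"
    using ps(2,3) by (intro exI[of _ "map fst ps"]) auto
next
  assume "\<exists>as. distinct as \<and> set as = A \<and> x = list_val (map (\<lambda>a. Nd (r a) (s (f a))) as)"
  then obtain as where as: "distinct as" "set as = A" "x = list_val (map (\<lambda>a. Nd (r a) (s (f a))) as)"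
    by blast
  then show "enc_fun (\<lambda>a x. x = r a) (\<lambda>b x. x = s b) A f x"
    by (auto simp: enc_fun_def enc_pair_eq enc_set_eq comp_def distinct_map inj_on_def
        intro!: exI[of _ "map (\<lambda>a. (a, f a)) as"])
qed

definition arc_val :: "nat \<times> nat \<Rightarrow> val" where
  "arc_val e = Nd (nat_val (fst e)) (nat_val (snd e))"

lemma arc_val_inject [simp]: "arc_val e = arc_val e' \<longleftrightarrow> e = e'"
  by (auto simp: arc_val_def prod_eq_iff)

lemma incident_arc_val: "incident (arc_val e) (nat_val v) \<longleftrightarrow> fst e = v \<or> snd e = v"
  by (simp add: incident_def arc_val_def)

lemma vertex_okD:
  assumes "vertex_ok F x v S"
  shows "a \<in> set (in_f x) \<Longrightarrow> incident (lft a) v \<Longrightarrow>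
      arc_ok F x (times (walk_length F x) S (lft a)) (lft a) (rgt a)"
    and "Nd t e \<in> set (list_of S) \<Longrightarrow> rgt e = v \<Longrightarrow>
      \<exists>q'\<in>set (list_of S). q' \<noteq> Lf \<and> lft (rgt q') = v \<and>
        lft q' = (if Nd Lf t = nv (walk_length F x) then Lf else Nd Lf t)"
    and "Nd Lf e \<in> set (list_of S) \<Longrightarrow> lft e = v \<Longrightarrow> v = in_root x"
  using assms unfolding vertex_ok_def by (simp, force+)

section \<open>Traversals and positions in a walk\<close>

lemma length_traversals: "length (traversals w e) = card {i. i < length w \<and> w ! i = e}"
  unfolding traversals_def length_filter_conv_card
  by (intro arg_cong[of _ _ card]) auto

lemma sum_card_positions:
  assumes "finite A"
  shows "card {i. i < length w \<and> w ! i \<in> A} = (\<Sum>e\<in>A. length (traversals w e))"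
proof -
  have "{i. i < length w \<and> w ! i \<in> A} = (\<Union>e\<in>A. {i. i < length w \<and> w ! i = e})" by auto
  then show ?thesis
    using assms by (simp add: length_traversals) (subst card_UN_disjoint; auto)
qed

lemma pcas_nth:
  assumes "w \<noteq> []"
  shows "pcas u w v \<longleftrightarrow> fst (w ! 0) = u \<and> snd (w ! (length w - 1)) = v \<and>
    (\<forall>i. Suc i < length w \<longrightarrow> snd (w ! i) = fst (w ! Suc i))"
  using assms
proof (induction w arbitrary: u)
  case (Cons e w)
  show ?case
  proof (cases "w = []")
    case False
    have "(\<forall>i. Suc i < length (e # w) \<longrightarrow> snd ((e # w) ! i) = fst ((e # w) ! Suc i)) \<longleftrightarrow>
        snd e = fst (w ! 0) \<and> (\<forall>i. Suc i < length w \<longrightarrow> snd (w ! i) = fst (w ! Suc i))"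
      using False by (auto simp: All_less_Suc2 nth_Cons split: nat.splits)
    with Cons.IH[OF False] False show ?thesis by auto
  qed simp
qed simp

lemma steps_between_eq_gap:
  assumes "y \<in> {1..length (traversals w e)}"
  shows "steps_between w e y = gap (length w) (traversals w e) y"
proof -
  have "y - 1 < length (traversals w e)" "0 < length (traversals w e)" using assms by auto
  then show ?thesis by (simp add: steps_between_def gap_def nth0_def Let_def)
qed

text \<open>The table of \<open>f\<close> is described as a list without repetitions since
  \<open>walk_length\<close> sums over it; for the vertices and the table of \<open>g\<close> the
  set of entries suffices.\<close>

locale decoded_instance =
  fixes F :: nat and V :: "nat set" and E :: "nat set set" and d :: nat
    and f :: "nat \<times> nat \<Rightarrow> nat" and g :: "(nat \<times> nat) \<times> nat \<Rightarrow> nat"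
    and x :: val and es :: "(nat \<times> nat) list"
  assumes graph: "simple_graph V E" and root: "d \<in> V"
    and f_le: "e \<in> sym_arcs E \<Longrightarrow> f e \<le> F"
    and verts_x: "set (in_verts x) = nat_val ` V"
    and root_x: "in_root x = nat_val d"
    and es: "distinct es" "set es = sym_arcs E"
    and f_x: "in_f x = map (\<lambda>e. Nd (arc_val e) (nat_val (f e))) es"
    and g_x: "set (in_g x) =
      (\<lambda>p. Nd (Nd (arc_val (fst p)) (nat_val (snd p))) (nat_val (g p))) ` (sym_arcs E \<times> {1..F})"
begin

abbreviation L :: nat where
  "L \<equiv> walk_length F x"

lemma finite_arcs: "finite (sym_arcs E)"
  using es(2) by (metis finite_set)

lemma walk_length_eq: "L = (\<Sum>e\<in>sym_arcs E. f e)"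
proof -
  have "L = (\<Sum>e\<leftarrow>es. f e)"
    unfolding walk_length_def f_x using f_le es(2)
    by (auto simp: comp_def unary_upto_nat_val intro!: arg_cong[of _ _ sum_list])
  then show ?thesis using es by (simp add: sum_list_distinct_conv_sum_set)
qed

lemma arc_ends:
  assumes "e \<in> sym_arcs E"
  shows "fst e \<in> V" "snd e \<in> V" "{fst e, snd e} \<in> E" "fst e \<noteq> snd e"
proof -
  from assms show E: "{fst e, snd e} \<in> E" by (auto simp: sym_arcs_def)
  with graph have "{fst e, snd e} \<subseteq> V" "card {fst e, snd e} = 2" by (auto simp: simple_graph_def)
  then show "fst e \<in> V" "snd e \<in> V" "fst e \<noteq> snd e" by auto
qed

text \<open>For \<open>i < F\<close> the key of \<open>e\<close> and \<open>Suc i\<close> occurs in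
  the table of \<open>g\<close> with exactly one value, so quantifying over entries amounts to a
  lookup.\<close>

lemma arc_ok_iff:
  assumes e: "e \<in> sym_arcs E"
  shows "arc_ok F x p (arc_val e) (nat_val (f e)) \<longleftrightarrow>
    length p = f e \<and> (\<forall>y\<in>{1..f e}. gap L p y \<le> g (e, y))"
proof (cases "length p = f e")
  case True
  have "(\<forall>c\<in>set (in_g x). lft c = Nd (arc_val e) (nat_val (Suc i)) \<longrightarrow>
      rgt c \<notin> set (map nat_val [0..<gap L p (Suc i)])) \<longleftrightarrow> gap L p (Suc i) \<le> g (e, Suc i)"
    if "i < F" for i
    using that e by (auto simp: g_x not_less image_iff)
  then have "arc_ok F x p (arc_val e) (nat_val (f e)) \<longleftrightarrow>
      (\<forall>i<F. i < f e \<longrightarrow> gap L p (Suc i) \<le> g (e, Suc i))"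
    using True unfolding arc_ok_def by simp
  also have "\<dots> \<longleftrightarrow> (\<forall>i<f e. gap L p (Suc i) \<le> g (e, Suc i))"
    using f_le[OF e] by auto
  also have "\<dots> \<longleftrightarrow> (\<forall>y\<in>{1..f e}. gap L p y \<le> g (e, y))"
    by (auto simp: Suc_le_eq) (metis Suc_le_eq Suc_pred)
  finally show ?thesis using True by simp
qed (auto simp: arc_ok_def)

definition is_walk :: "(nat \<times> nat) list \<Rightarrow> bool" where
  "is_walk w \<longleftrightarrow> pcas d w d \<and> set w \<subseteq> sym_arcs E \<and>
     (\<forall>e\<in>sym_arcs E. length (traversals w e) = f e) \<and>
     (\<forall>e\<in>sym_arcs E. \<forall>y\<in>{1..f e}. steps_between w e y \<le> g (e, y))"

lemma mem_slots:
  "q \<in> set (slots F x) \<longleftrightarrow> q = Lf \<or> (\<exists>t<L. \<exists>e\<in>sym_arcs E. q = Nd (nv t) (arc_val e))"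
  by (auto simp: slots_def f_x es(2))

text \<open>
  Summing the numbers of traversals shows that \<open>L\<close> arcs are scheduled.  The times scheduled are
  closed under the cyclic successor, hence each of the \<open>L\<close> times is used, hence exactly once.
\<close>

lemma walk_if_timetables:
  assumes v: "\<And>v. v \<in> V \<Longrightarrow> vertex_ok F x (nat_val v) (S v)"
    and sl: "\<And>v. v \<in> V \<Longrightarrow> set (list_of (S v)) \<subseteq> set (slots F x)"
    and p: "\<And>u v. {u, v} \<in> E \<Longrightarrow> pair_ok F x (Nd (nat_val u) (S u)) (Nd (nat_val v) (S v))"
  shows "\<exists>w. is_walk w"
proof -
  define T where "T e = times L (S (fst e)) (arc_val e)" for e
  have T_ok: "length (T e) = f e" "\<forall>y\<in>{1..f e}. gap L (T e) y \<le> g (e, y)"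
    if e: "e \<in> sym_arcs E" for e
  proof -
    have "Nd (arc_val e) (nat_val (f e)) \<in> set (in_f x)" using e es(2) by (auto simp: f_x)
    from vertex_okD(1)[OF v[OF arc_ends(1)[OF e]] this]
    have "arc_ok F x (T e) (arc_val e) (nat_val (f e))"
      by (simp add: incident_arc_val T_def)
    then show "length (T e) = f e" "\<forall>y\<in>{1..f e}. gap L (T e) y \<le> g (e, y)"
      using arc_ok_iff[OF e] by auto
  qed
  have T_head: "T e = times L (S (snd e)) (arc_val e)" if e: "e \<in> sym_arcs E" for e
  proof -
    have "Nd (arc_val e) (nat_val (f e)) \<in> set (in_f x)" using e es(2) by (auto simp: f_x)
    with p[OF arc_ends(3)[OF e]] show ?thesis
      unfolding pair_ok_def by (auto simp: incident_arc_val T_def)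
  qed
  \<comment> \<open>The scheduled traversals, as pairs of arc and time; one time might still belong
    to several arcs or to none.\<close>
  define R where "R = (SIGMA e:sym_arcs E. set (T e))"
  have "card R = (\<Sum>e\<in>sym_arcs E. card (set (T e)))"
    unfolding R_def by (intro card_SigmaI finite_arcs) auto
  also have "\<dots> = (\<Sum>e\<in>sym_arcs E. f e)"
    using T_ok(1) by (intro sum.cong refl) (simp add: T_def times_def distinct_card[symmetric])
  finally have cardR: "card R = L" by (simp add: walk_length_eq)
  have finR: "finite R" unfolding R_def using finite_arcs by auto
  have R_less: "t < L" if "(e, t) \<in> R" for e t
    using that by (auto simp: R_def T_def times_def)
  \<comment> \<open>By \<open>T_head\<close> the arrival along \<open>e\<close> is also recorded at
    the head of \<open>e\<close>. There \<open>vertex_ok\<close> supplies a departure, and the tail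
    of the departing arc is that same vertex.\<close>
  have succ: "\<exists>e'. (e', Suc t mod L) \<in> R \<and> fst e' = snd e" if et: "(e, t) \<in> R" for e t
  proof -
    from et have e: "e \<in> sym_arcs E" by (simp add: R_def)
    note V = arc_ends(2)[OF e]
    let ?q = "Nd (nv t) (arc_val e)"
    from et T_head[OF e] have q: "?q \<in> set (list_of (S (snd e)))"
      by (auto simp: R_def times_def)
    with vertex_okD(2)[OF v[OF V] q] obtain q' where q': "q' \<in> set (list_of (S (snd e)))" "q' \<noteq> Lf"
      "lft (rgt q') = nat_val (snd e)"
      "lft q' = (if Nd Lf (nv t) = nv L then Lf else Nd Lf (nv t))"
      by (auto simp: arc_val_def)
    from q'(1,2) sl[OF V] obtain t' e' where t': "t' < L" "e' \<in> sym_arcs E" "q' = Nd (nv t') (arc_val e')"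
      by (auto simp: mem_slots dest!: subsetD)
    have "t' = Suc t mod L"
      using q'(4) t' R_less[OF et] by (auto simp: t'(3) nv_Suc[symmetric] split: if_splits)
    moreover have "fst e' = snd e" using q'(3) by (simp add: t'(3) arc_val_def)
    moreover have "t' \<in> set (T e')"
      using q'(1) t'(1) by (simp add: T_def times_def t'(3) \<open>fst e' = snd e\<close>)
    ultimately show ?thesis using t'(2) by (intro exI[of _ e']) (simp add: R_def)
  qed
  show ?thesis
  proof (cases "L = 0")
    case True
    \<comment> \<open>Without any traversal there is no modulus for times; the empty walk is a
      solution.\<close>
    then have "f e = 0" if "e \<in> sym_arcs E" for e
      using that finite_arcs by (simp add: walk_length_eq)
    then have "is_walk []" by (auto simp: is_walk_def traversals_def)
    then show ?thesis by blast
  next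
    case False
    then have "R \<noteq> {}" using cardR by auto
    then obtain e0 t0 where et0: "(e0, t0) \<in> R" by auto
    have "(t0 + n) mod L \<in> snd ` R" for n
    proof (induction n)
      case 0
      then show ?case using et0 R_less[OF et0] by force
    next
      case (Suc n)
      then obtain e where "(e, (t0 + n) mod L) \<in> R" by auto
      from succ[OF this] show ?case by (auto simp: mod_Suc_eq image_iff intro: bexI[rotated])
    qed
    from this[of "L - t0 + t" for t] have "t \<in> snd ` R" if "t < L" for t
      using that R_less[OF et0] by (metis add.assoc less_imp_le_nat le_add_diff_inverse mod_add_self1 mod_less)
    then have im: "snd ` R = {..<L}" using R_less by force
    then have inj: "inj_on snd R"
      using finR cardR by (intro eq_card_imp_inj_on) auto
    define w where "w = map (\<lambda>t. SOME e. (e, t) \<in> R) [0..<L]"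
    have len: "length w = L" by (simp add: w_def)
    have wR: "(w ! t, t) \<in> R" if "t < L" for t
    proof -
      from that im obtain e where "(e, t) \<in> R" by (metis image_iff lessThan_iff prod.collapse)
      then have "(SOME e. (e, t) \<in> R, t) \<in> R" by (rule someI)
      with that show ?thesis by (simp add: w_def)
    qed
    have uniq: "e = w ! t" if "(e, t) \<in> R" for e t
      using inj_onD[OF inj _ that wR[OF R_less[OF that]]] by simp
    have trav: "traversals w e = T e" if e: "e \<in> sym_arcs E" for e
    proof -
      have "w ! t = e \<longleftrightarrow> Nd (nv t) (arc_val e) \<in> set (list_of (S (fst e)))" if "t < L" for t
        using that wR[OF that] uniq[of e t] e by (auto simp: R_def T_def times_def)
      then show ?thesis unfolding traversals_def T_def times_def len
        by (intro filter_cong) auto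
    qed
    have next_arc: "fst (w ! (Suc t mod L)) = snd (w ! t)" if "t < L" for t
      using succ[OF wR[OF that]] uniq by auto
    have "fst (w ! 0) = d"
    proof -
      have R0: "(w ! 0, 0) \<in> R" using wR False by simp
      then have e: "w ! 0 \<in> sym_arcs E" by (simp add: R_def)
      from R0 have "Nd Lf (arc_val (w ! 0)) \<in> set (list_of (S (fst (w ! 0))))"
        by (auto simp: R_def T_def times_def)
      from vertex_okD(3)[OF v[OF arc_ends(1)[OF e]] this] show ?thesis
        by (simp add: arc_val_def root_x)
    qed
    moreover have "w \<noteq> []" using False len by auto
    moreover have "snd (w ! (L - 1)) = d"
      using next_arc[of "L - 1"] False \<open>fst (w ! 0) = d\<close> by simp
    moreover have "snd (w ! i) = fst (w ! Suc i)" if "Suc i < L" for i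
      using next_arc[of i] that by simp
    ultimately have "pcas d w d" by (simp add: pcas_nth len)
    moreover have "w ! t \<in> sym_arcs E" if "t < L" for t
      using wR[OF that] by (simp add: R_def)
    then have "set w \<subseteq> sym_arcs E" by (metis in_set_conv_nth len subsetI)
    ultimately have "is_walk w"
      using T_ok by (simp add: is_walk_def trav steps_between_eq_gap len)
    then show ?thesis by blast
  qed
qed

text \<open>Arcs leaving \<open>v\<close> and arcs entering \<open>v\<close> each inject into the
  edges at \<open>v\<close>, whence the factor 2.\<close>

lemma card_incident_arcs:
  assumes "degree E v \<le> D"
  shows "card {e \<in> sym_arcs E. fst e = v \<or> snd e = v} \<le> 2 * D"
proof -
  have "finite E" using graph by (auto simp: simple_graph_def intro: finite_subset[of _ "Pow V"])
  then have fin: "finite {e \<in> E. v \<in> e}" by simp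
  have "card {e \<in> sym_arcs E. fst e = v} \<le> card {e \<in> E. v \<in> e}"
    by (rule card_inj_on_le[OF _ _ fin, of "\<lambda>e. {fst e, snd e}"])
      (auto simp: inj_on_def sym_arcs_def doubleton_eq_iff)
  moreover have "card {e \<in> sym_arcs E. snd e = v} \<le> card {e \<in> E. v \<in> e}"
    by (rule card_inj_on_le[OF _ _ fin, of "\<lambda>e. {fst e, snd e}"])
      (auto simp: inj_on_def sym_arcs_def doubleton_eq_iff)
  moreover have "{e \<in> sym_arcs E. fst e = v \<or> snd e = v} =
      {e \<in> sym_arcs E. fst e = v} \<union> {e \<in> sym_arcs E. snd e = v}" by auto
  ultimately show ?thesis
    using assms card_Un_le[of "{e \<in> sym_arcs E. fst e = v}" "{e \<in> sym_arcs E. snd e = v}"]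
    by (simp add: degree_def)
qed

lemma decide_if_walk:
  assumes w: "is_walk w" and deg: "\<And>v. v \<in> V \<Longrightarrow> degree E v \<le> D" and k: "k > 0"
  shows "decide F (2 * D * F) k x"
proof -
  have trav: "length (traversals w e) = f e" if "e \<in> sym_arcs E" for e
    using w that by (simp add: is_walk_def)
  have w_nth: "w ! t \<in> sym_arcs E" if "t < length w" for t
    using w that by (auto simp: is_walk_def)
  \<comment> \<open>Every position carries an arc, so summing the prescribed numbers of traversals
    gives the length of the walk.\<close>
  have "{i. i < length w \<and> w ! i \<in> sym_arcs E} = {..<length w}" using w_nth by auto
  with sum_card_positions[OF finite_arcs, of w] trav have len: "length w = L"
    by (simp add: walk_length_eq)
  have next_arc: "fst (w ! (Suc t mod L)) = snd (w ! t)" "fst (w ! 0) = d" if "t < L" for t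
  proof -
    have "w \<noteq> []" using that len by auto
    with w have *: "fst (w ! 0) = d" "snd (w ! (L - 1)) = d"
      "\<And>i. Suc i < L \<Longrightarrow> snd (w ! i) = fst (w ! Suc i)"
      by (auto simp: is_walk_def pcas_nth len)
    then show "fst (w ! 0) = d" by simp
    show "fst (w ! (Suc t mod L)) = snd (w ! t)"
    proof (cases "Suc t = L")
      case True
      then have "t = L - 1" by simp
      with True * show ?thesis by simp
    qed (use * that in simp)
  qed
  define P where "P v = filter (\<lambda>t. fst (w ! t) = v \<or> snd (w ! t) = v) [0..<L]" for v
  define S where "S v = list_val (map (\<lambda>t. Nd (nv t) (arc_val (w ! t))) (P v) @
    replicate (2 * D * F - length (P v)) Lf)" for v
  have lenP: "length (P v) \<le> 2 * D * F" if "v \<in> V" for v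
  proof -
    let ?A = "{e \<in> sym_arcs E. fst e = v \<or> snd e = v}"
    have "length (P v) = card {i. i < length w \<and> w ! i \<in> ?A}"
      unfolding P_def length_filter_conv_card using w_nth
      by (intro arg_cong[of _ _ card]) (auto simp: len)
    also have "\<dots> = (\<Sum>e\<in>?A. length (traversals w e))"
      by (rule sum_card_positions) (simp add: finite_arcs)
    also have "\<dots> \<le> (\<Sum>e\<in>?A. F)" by (rule sum_mono) (use trav f_le in auto)
    also have "\<dots> \<le> 2 * D * F" using card_incident_arcs[OF deg[OF that]] by simp
    finally show ?thesis .
  qed
  have mem: "q \<in> set (list_of (S v)) \<and> q \<noteq> Lf \<longleftrightarrow>
      (\<exists>t<L. (fst (w ! t) = v \<or> snd (w ! t) = v) \<and> q = Nd (nv t) (arc_val (w ! t)))" for q v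
    by (auto simp: S_def P_def)
  \<comment> \<open>The result is the same at both ends of \<open>e\<close>, which is why the
    timetables of neighbours agree.\<close>
  have times: "times L (S v) (arc_val e) = traversals w e" if "fst e = v \<or> snd e = v" for v e
    unfolding times_def traversals_def len
    using mem[of "Nd (nv _) (arc_val e)" v] that by (intro filter_cong) auto
  have vok: "vertex_ok F x (nat_val v) (S v)" if v: "v \<in> V" for v
    unfolding vertex_ok_def
  proof (intro conjI ballI impI)
    fix a
    assume a: "a \<in> set (in_f x)" "incident (lft a) (nat_val v)"
    then obtain e where e: "e \<in> sym_arcs E" "a = Nd (arc_val e) (nat_val (f e))"
      by (auto simp: f_x es(2))
    with a(2) have "fst e = v \<or> snd e = v" by (simp add: incident_arc_val)
    note T = times[OF this]
    have "gap L (traversals w e) y \<le> g (e, y)" if y: "y \<in> {1..f e}" for y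
    proof -
      have "steps_between w e y \<le> g (e, y)" using w e(1) y by (simp add: is_walk_def)
      then show ?thesis
        using steps_between_eq_gap[of y w e] y by (simp only: trav[OF e(1)] len)
    qed
    then have "arc_ok F x (times L (S v) (arc_val e)) (arc_val e) (nat_val (f e))"
      unfolding T arc_ok_iff[OF e(1)] using trav[OF e(1)] by blast
    then show "arc_ok F x (times L (S v) (lft a)) (lft a) (rgt a)" by (simp add: e(2))
  next
    fix q
    assume "q \<in> set (list_of (S v))" "q \<noteq> Lf \<and> rgt (rgt q) = nat_val v"
    then obtain t where t: "t < L" "q = Nd (nv t) (arc_val (w ! t))" "snd (w ! t) = v"
      using mem[of q v] by (auto simp: arc_val_def)
    let ?t = "Suc t mod L" and ?q = "Nd (nv (Suc t mod L)) (arc_val (w ! (Suc t mod L)))"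
    have "?t < L" "fst (w ! ?t) = v" using next_arc(1)[OF t(1)] t by auto
    then have "?q \<in> set (list_of (S v))" using mem[of ?q v] by auto
    moreover have "nv ?t = (if Nd Lf (nv t) = nv L then Lf else Nd Lf (nv t))"
      using t(1) by (cases "Suc t = L") (auto simp flip: nv_Suc)
    ultimately show "\<exists>q'\<in>set (list_of (S v)). q' \<noteq> Lf \<and> lft (rgt q') = nat_val v \<and>
        lft q' = (if Nd Lf (lft q) = nv L then Lf else Nd Lf (lft q))"
      using \<open>fst (w ! ?t) = v\<close> t(2) by (intro bexI[of _ ?q]) (simp_all add: arc_val_def)
  next
    fix q
    assume "q \<in> set (list_of (S v))" "q \<noteq> Lf \<and> lft (rgt q) = nat_val v \<and> lft q = Lf"
    then obtain t where "t < L" "q = Nd (nv t) (arc_val (w ! t))" "fst (w ! t) = v" "t = 0"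
      using mem[of q v] by (auto simp: arc_val_def)
    with next_arc(2) show "nat_val v = in_root x" by (simp add: root_x)
  qed
  \<comment> \<open>The procedure knows vertices by their codes, which determine them because
    \<open>nat_val\<close> is injective.\<close>
  define s where "s u = S (inv nat_val u)" for u
  have s: "s (nat_val v) = S v" for v
    by (simp add: s_def inv_f_f inj_on_def)
  show ?thesis
  proof (rule decide_if_solution[OF k, where s = s])
    show "in_verts x \<noteq> []" using root verts_x by auto
    fix u
    assume "u \<in> set (in_verts x)"
    then obtain v where v: "v \<in> V" "u = nat_val v" using verts_x by auto
    have "set (list_of (S v)) \<subseteq> set (slots F x)"
    proof
      fix q
      assume "q \<in> set (list_of (S v))"
      with mem[of q v] w_nth show "q \<in> set (slots F x)"
        by (cases "q = Lf") (auto simp: mem_slots len)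
    qed
    moreover have "length (list_of (S v)) = 2 * D * F" using lenP[OF v(1)] by (simp add: S_def)
    ultimately show "Nd u (s u) \<in> set (atoms F (2 * D * F) x)"
      using v vok[OF v(1)] verts_x by (simp add: mem_atoms s)
    fix u'
    assume "u' \<in> set (in_verts x)"
    then obtain v' where v': "u' = nat_val v'" using verts_x by auto
    show "pair_ok F x (Nd u (s u)) (Nd u' (s u'))"
      unfolding pair_ok_def v(2) v' by (auto simp: s f_x incident_arc_val times)
  qed
qed

lemma walk_if_decide:
  assumes dec: "decide F m k x" and k: "k > 0"
    and td: "tree_decomposition V E N T b" and card: "\<And>n. n \<in> N \<Longrightarrow> card (b n) \<le> k"
  shows "\<exists>w. is_walk w"
proof -
  from decideE[OF dec] obtain H where H: "H \<noteq> {}" "H \<subseteq> set (init_tuples F m k x)"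
    "\<And>h r v. h \<in> H \<Longrightarrow> length r = k - 1 \<Longrightarrow> set r \<subseteq> set (list_of h) \<Longrightarrow> v \<in> set (in_verts x) \<Longrightarrow>
      \<exists>h'\<in>H. rgt h' = list_val r \<and> lft (lft h') = v" by blast
  define A where "A h = {(v, S). Nd (nat_val v) S \<in> set (list_of h)}" for h
  let ?c = "\<lambda>p. Nd (nat_val (fst p)) (snd p)"
  have "\<exists>s. \<forall>n\<in>N. \<exists>B\<in>A ` H. \<forall>v\<in>b n. (v, s v) \<in> B"
  proof (rule tree_decomposition_glue[OF td _ card])
    show "finite V" using graph by (simp add: simple_graph_def)
    show "A ` H \<noteq> {}" using H(1) by simp
    fix B K W
    assume *: "B \<in> A ` H" "K \<subseteq> B" "finite K" "W \<subseteq> V" "card K + card W \<le> k"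
    then obtain h where h: "h \<in> H" "K \<subseteq> A h" by auto
    have "finite W" using *(4) graph finite_subset by (auto simp: simple_graph_def)
    then have "\<exists>h'\<in>H. ?c ` K \<subseteq> set (list_of h') \<and> nat_val ` W \<subseteq> lft ` set (list_of h')"
      using h *(3-5) verts_x card_image_le[of K ?c] card_image_le[of W nat_val]
      by (intro decide_extend[OF k H(2,3) h(1)]) (auto simp: A_def)
    then obtain h' where h': "h' \<in> H" "?c ` K \<subseteq> set (list_of h')" "nat_val ` W \<subseteq> lft ` set (list_of h')"
      by blast
    have "K \<subseteq> A h'" using h'(2) by (auto simp: A_def)
    moreover have "W \<subseteq> fst ` A h'"
    proof
      fix v
      assume "v \<in> W"
      with h'(3) obtain a where a: "a \<in> set (list_of h')" "lft a = nat_val v" by (auto simp: subset_iff image_iff)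
      with mem_init_tuples(2)[of h'] h'(1) H(2) obtain S where "a = Nd (nat_val v) S"
        using atoms_Nd by (metis in_mono lft.simps(2))
      with a(1) have "(v, S) \<in> A h'" by (simp add: A_def)
      then show "v \<in> fst ` A h'" by force
    qed
    ultimately show "\<exists>A'\<in>A ` H. K \<subseteq> A' \<and> W \<subseteq> fst ` A'" using h'(1) by blast
  qed
  then obtain s where s: "\<And>n. n \<in> N \<Longrightarrow> \<exists>h\<in>H. \<forall>v\<in>b n. Nd (nat_val v) (s v) \<in> set (list_of h)"
    by (auto simp: A_def)
  have at: "Nd (nat_val v) (s v) \<in> set (atoms F m x)" if v: "v \<in> V" for v
  proof -
    from td v obtain n where "n \<in> N" "v \<in> b n" by (auto simp: tree_decomposition_def)
    with s[of n] mem_init_tuples(2) H(2) show ?thesis by blast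
  qed
  show ?thesis
  proof (rule walk_if_timetables[where S = s])
    show "vertex_ok F x (nat_val v) (s v)" "set (list_of (s v)) \<subseteq> set (slots F x)" if "v \<in> V" for v
      using at[OF that] by (auto simp: mem_atoms)
    fix u v
    assume "{u, v} \<in> E"
    \<comment> \<open>An edge lies in one bag, so the timetables of its ends come from one tuple,
      whose members are pairwise compatible.\<close>
    with td obtain n where "n \<in> N" "u \<in> b n" "v \<in> b n" by (auto simp: tree_decomposition_def)
    with s[of n] mem_init_tuples(3) H(2)
    show "pair_ok F x (Nd (nat_val u) (s u)) (Nd (nat_val v) (s v))" by blast
  qed
qed

end

section \<open>Correctness on encoded instances\<close>

lemma decoded_instance_if_encoded:
  assumes "admissible F D k I" "enc_instance F I x"
  obtains es where "decoded_instance F (gV I) (gE I) (gd I) (fI I) (gI I) x es"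
proof -
  from assms(2) obtain x1 x2 x3 x4 x5 x6 x7 x8 x9 where
    x: "x = list_val [x1, x2, x3, x4, x5, x6, x7, x8, x9]"
    and x1: "enc_set enc_nat (gV I) x1" and x3: "enc_nat (gd I) x3"
    and x8: "enc_fun (enc_pair enc_nat enc_nat) enc_nat (sym_arcs (gE I)) (fI I) x8"
    and x9: "enc_fun (enc_pair (enc_pair enc_nat enc_nat) enc_nat) enc_nat
          (sym_arcs (gE I) \<times> {1..F}) (gI I) x9"
    unfolding enc_instance_def by blast
  from x8 obtain es where es: "distinct es" "set es = sym_arcs (gE I)"
    "x8 = list_val (map (\<lambda>e. Nd (arc_val e) (nat_val (fI I e))) es)"
    by (auto simp: enc_nat_eq enc_pair_eq enc_fun_eq arc_val_def)
  from x9 obtain ps where ps: "set ps = sym_arcs (gE I) \<times> {1..F}"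
    "x9 = list_val (map (\<lambda>p. Nd (Nd (arc_val (fst p)) (nat_val (snd p))) (nat_val (gI I p))) ps)"
    by (auto simp: enc_nat_eq enc_pair_eq enc_fun_eq arc_val_def)
  from x1 obtain vs where vs: "set vs = gV I" "x1 = list_val (map nat_val vs)"
    by (auto simp: enc_nat_eq enc_set_eq)
  have "decoded_instance F (gV I) (gE I) (gd I) (fI I) (gI I) x es"
    using assms(1) es ps vs x3
    by unfold_locales
      (auto simp: admissible_def x in_verts_def in_root_def in_f_def in_g_def enc_nat_def)
  with that show thesis .
qed

lemma decide_correct:
  assumes adm: "admissible F D k I" and enc: "enc_instance F I x"
  shows "decide F (2 * D * F) k x \<longleftrightarrow> has_walk I"
proof -
  obtain es where "decoded_instance F (gV I) (gE I) (gd I) (fI I) (gI I) x es"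
    using decoded_instance_if_encoded[OF assms] .
  then interpret decoded_instance F "gV I" "gE I" "gd I" "fI I" "gI I" x es .
  have walk: "has_walk I \<longleftrightarrow> (\<exists>w. is_walk w)"
    using root by (auto simp: has_walk_def is_walk_def awalk_sym_orientation)
  have canon: "canonical_tree_decomposition (gV I) (gE I) (gd I) (tV I) (tE I) (tr I) (bag I)"
    and width: "width (tV I) (bag I) = int k - 1"
    using adm by (auto simp: admissible_def)
  then have td: "tree_decomposition (gV I) (gE I) (tV I) (tE I) (bag I)"
    and r: "tr I \<in> tV I" "gd I \<in> bag I (tr I)"
    by (auto simp: canonical_tree_decomposition_def)
  have fin: "finite (tV I)"
    using td by (simp add: tree_decomposition_def undirected_tree_def simple_graph_def)
  have "card (bag I n) \<le> k" if "n \<in> tV I" for n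
  proof -
    have "card (bag I n) \<le> Max ((\<lambda>x. card (bag I x)) ` tV I)"
      using fin that by (intro Max_ge) auto
    with width show ?thesis by (simp add: width_def)
  qed
  \<comment> \<open>The bag of the root contains \<open>gd I\<close>, so the maximal bag size is
    positive.\<close>
  moreover have "k > 0"
  proof -
    have "bag I (tr I) \<subseteq> gV I" using td r by (auto simp: tree_decomposition_def)
    then have "finite (bag I (tr I))" using graph finite_subset by (auto simp: simple_graph_def)
    then have "card (bag I (tr I)) > 0" using r(2) by (auto simp: card_gt_0_iff)
    with calculation[OF r(1)] show ?thesis by simp
  qed
  ultimately show ?thesis
    using walk_if_decide[OF _ _ td] decide_if_walk adm unfolding walk admissible_def by blast
qed

theorem theorem14:
  fixes F \<Delta> k :: nat
  shows "poly_time_decidable (admissible F \<Delta> k) (enc_instance F) has_walk"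
  by (rule poly_time_decidableI[OF ptimeb_decide]) (rule decide_correct)

end
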